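(* Let $(M^{2n},J,h,\tilde h)$ be a $2n$-dimensional holomorphic complex Riemannian manifold. Then the product manifold $M^{2n+1}=\mathbb R^+\times M^{2n}$, equipped with the almost contact complex Riemannian structure $$\eta=dt,\qquad \varphi|_{\mathcal H}=J,\qquad \eta\circ\varphi=0,\qquad g=dt^2+\cos(2t)\,h-\sin(2t)\,\tilde h,$$ is a Sasaki-like almost contact complex Riemannian manifold. If $M^{2n}$ is compact and $S^1$ is a 1-dimensional sphere, then $M^{2n+1}=S^1\times M^{2n}$ with the same structure is a compact Sasaki-like almost contact complex Riemannian manifold.
   Context: A holomorphic complex Riemannian manifold $(M^{2n},J,h,\tilde h)$ is a manifold with almost complex structure $J$ and a pseudo-Riemannian metric $h$ of signature $(n,n)$ such that $h(JX,JY)=-h(X,Y)$ and $DJ=0$ for the Levi-Civita connection $D$ of $h$; here $\tilde h(X,Y)=h(JX,Y)$. On the product, $t$ is the coordinate on $\mathbb R^+$ (for $S^1$, the factor is the quotient of the $t$-line under which the $t$-periodic metric descends), $\mathcal H=\ker\eta$ is identified with $TM^{2n}$, and $\xi=\partial/\partial t$, $\varphi\xi=0$. An almost contact complex Riemannian manifold $(M,\varphi,\xi,\eta,g)$ is a $(2n+1)$-dimensional manifold with $\varphi\xi=0$, $\varphi^2=-I+\eta\otimes\xi$, $\eta\circ\varphi=0$, $\eta(\xi)=1$, and a pseudo-Riemannian metric $g$ of signature $(n+1,n)$ with $g(\varphi x,\varphi y)=-g(x,y)+\eta(x)\eta(y)$. With $\nabla$ its Levi-Civita connection and $F(x,y,z)=g((\nabla_x\varphi)y,z)$,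 it is called Sasaki-like if for all $X,Y,Z\in\ker\eta$: $F(X,Y,Z)=F(\xi,Y,Z)=F(\xi,\xi,Z)=0$ and $F(X,Y,\xi)=-g(X,Y)$. *)

theory Defs
  imports "HOL-Analysis.Analysis"
begin

section \<open>Smooth maps between Euclidean spaces\<close>

text \<open>
  Only applied to open sets \<open>S\<close> of a Euclidean space, where having a directional derivative of
  class \<open>C\<^sup>k\<close> in every fixed direction \<open>v\<close> amounts to the derivative being of class \<open>C\<^sup>k\<close>.
\<close>

primrec Ck_on :: "nat \<Rightarrow> 'a::euclidean_space set \<Rightarrow> ('a \<Rightarrow> 'b::real_normed_vector) \<Rightarrow> bool" where
  "Ck_on 0 S f \<longleftrightarrow> continuous_on S f"
| "Ck_on (Suc k) S f \<longleftrightarrow>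
     (\<forall>x\<in>S. f differentiable (at x)) \<and>
     (\<forall>v. Ck_on k S (\<lambda>x. frechet_derivative f (at x) v))"

definition smooth_on :: "'a::euclidean_space set \<Rightarrow> ('a \<Rightarrow> 'b::real_normed_vector) \<Rightarrow> bool" where
  "smooth_on S f \<longleftrightarrow> (\<forall>k. Ck_on k S f)"

abbreviation dir_deriv :: "('a::euclidean_space \<Rightarrow> 'b::real_normed_vector) \<Rightarrow> 'a \<Rightarrow> 'a \<Rightarrow> 'b" where
  "dir_deriv f x v \<equiv> frechet_derivative f (at x) v"


section \<open>Smooth manifolds\<close>

text \<open>
  A manifold is a topological space with an indexed smooth atlas: for \<open>i \<in> idx A\<close> the map
  \<open>chart A i\<close> is a chart with domain \<open>cdom A i\<close>. The dimension is that of the model space \<open>'e\<close>.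
\<close>

record ('a, 'i, 'e) manifold =
  topo :: "'a topology"
  idx :: "'i set"
  cdom :: "'i \<Rightarrow> 'a set"
  chart :: "'i \<Rightarrow> 'a \<Rightarrow> 'e"

definition coords :: "('a, 'i, 'e) manifold \<Rightarrow> 'i \<Rightarrow> 'e set" where
  "coords A i = chart A i ` cdom A i"

definition overlap :: "('a, 'i, 'e) manifold \<Rightarrow> 'i \<Rightarrow> 'i \<Rightarrow> 'e set" where
  "overlap A i j = chart A i ` (cdom A i \<inter> cdom A j)"

definition transition :: "('a, 'i, 'e) manifold \<Rightarrow> 'i \<Rightarrow> 'i \<Rightarrow> 'e \<Rightarrow> 'e" where
  "transition A i j = chart A j \<circ> inv_into (cdom A i) (chart A i)"

definition smooth_manifold :: "('a, 'i, 'e::euclidean_space) manifold \<Rightarrow> bool" where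
  "smooth_manifold A \<longleftrightarrow>
     Hausdorff_space (topo A) \<and> second_countable (topo A) \<and>
     (\<Union>i\<in>idx A. cdom A i) = topspace (topo A) \<and>
     (\<forall>i\<in>idx A. openin (topo A) (cdom A i) \<and> open (coords A i) \<and>
        homeomorphic_map (subtopology (topo A) (cdom A i)) (top_of_set (coords A i)) (chart A i)) \<and>
     (\<forall>i\<in>idx A. \<forall>j\<in>idx A. smooth_on (overlap A i j) (transition A i j))"

definition product_manifold ::
  "('b, 'k, 'f) manifold \<Rightarrow> ('a, 'i, 'e) manifold \<Rightarrow> ('b \<times> 'a, 'k \<times> 'i, 'f \<times> 'e) manifold" where
  "product_manifold T A =
     \<lparr>topo = prod_topology (topo T) (topo A),
      idx = idx T \<times> idx A,
      cdom = (\<lambda>(k, i). cdom T k \<times> cdom A i),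
      chart = (\<lambda>(k, i). map_prod (chart T k) (chart A i))\<rparr>"

definition positive_reals :: "(real, unit, real) manifold" where
  "positive_reals =
     \<lparr>topo = top_of_set {0<..}, idx = UNIV, cdom = (\<lambda>_. {0<..}), chart = (\<lambda>_ t. t)\<rparr>"

text \<open>
  The circle obtained from the \<open>t\<close>-line by identifying \<open>t\<close> with \<open>t + L\<close>, realised as the unit circle
  via \<open>t \<mapsto> cis (2 * pi * t / L)\<close>. For every real \<open>a\<close> there is a chart given by the coordinate
  \<open>t \<in> {a<..<a + L}\<close>, defined off the class of \<open>a\<close>.
\<close>

definition circle :: "real \<Rightarrow> (complex, real, real) manifold" where
  "circle L =
     \<lparr>topo = top_of_set (sphere 0 1),
      idx = UNIV,
      cdom = (\<lambda>a. sphere 0 1 - {cis (2 * pi * a / L)}),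
      chart = (\<lambda>a z. THE t. t \<in> {a<..<a + L} \<and> cis (2 * pi * t / L) = z)\<rparr>"


section \<open>Tensor fields\<close>

text \<open>
  Tensor fields are given by their representatives in the charts: the first argument is the index
  of a chart, the second the coordinates of the base point in that chart, and tangent vectors are
  represented by elements of the model space. Nothing is required at points outside \<open>coords A i\<close>.
\<close>

type_synonym ('i, 'e) vfield = "'i \<Rightarrow> 'e \<Rightarrow> 'e"
type_synonym ('i, 'e) oneform = "'i \<Rightarrow> 'e \<Rightarrow> 'e \<Rightarrow> real"
type_synonym ('i, 'e) endofield = "'i \<Rightarrow> 'e \<Rightarrow> 'e \<Rightarrow> 'e"
type_synonym ('i, 'e) formfield = "'i \<Rightarrow> 'e \<Rightarrow> 'e \<Rightarrow> 'e \<Rightarrow> real"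
type_synonym ('i, 'e) connfield = "'i \<Rightarrow> 'e \<Rightarrow> 'e \<Rightarrow> 'e \<Rightarrow> 'e"

definition vector_field :: "('a, 'i, 'e::euclidean_space) manifold \<Rightarrow> ('i, 'e) vfield \<Rightarrow> bool" where
  "vector_field A X \<longleftrightarrow>
     (\<forall>i\<in>idx A. smooth_on (coords A i) (X i)) \<and>
     (\<forall>i\<in>idx A. \<forall>j\<in>idx A. \<forall>x\<in>overlap A i j.
        X j (transition A i j x) = dir_deriv (transition A i j) x (X i x))"

definition one_form :: "('a, 'i, 'e::euclidean_space) manifold \<Rightarrow> ('i, 'e) oneform \<Rightarrow> bool" where
  "one_form A \<omega> \<longleftrightarrow>
     (\<forall>i\<in>idx A. (\<forall>x\<in>coords A i. linear (\<omega> i x)) \<and> (\<forall>v. smooth_on (coords A i) (\<lambda>x. \<omega> i x v))) \<and>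
     (\<forall>i\<in>idx A. \<forall>j\<in>idx A. \<forall>x\<in>overlap A i j. \<forall>v.
        \<omega> j (transition A i j x) (dir_deriv (transition A i j) x v) = \<omega> i x v)"

definition endo_field :: "('a, 'i, 'e::euclidean_space) manifold \<Rightarrow> ('i, 'e) endofield \<Rightarrow> bool" where
  "endo_field A J \<longleftrightarrow>
     (\<forall>i\<in>idx A. (\<forall>x\<in>coords A i. linear (J i x)) \<and> (\<forall>v. smooth_on (coords A i) (\<lambda>x. J i x v))) \<and>
     (\<forall>i\<in>idx A. \<forall>j\<in>idx A. \<forall>x\<in>overlap A i j. \<forall>v.
        J j (transition A i j x) (dir_deriv (transition A i j) x v) =
        dir_deriv (transition A i j) x (J i x v))"

definition bilinear_form_field :: "('a, 'i, 'e::euclidean_space) manifold \<Rightarrow> ('i, 'e) formfield \<Rightarrow> bool" where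
  "bilinear_form_field A h \<longleftrightarrow>
     (\<forall>i\<in>idx A. (\<forall>x\<in>coords A i. bilinear (h i x)) \<and>
        (\<forall>u v. smooth_on (coords A i) (\<lambda>x. h i x u v))) \<and>
     (\<forall>i\<in>idx A. \<forall>j\<in>idx A. \<forall>x\<in>overlap A i j. \<forall>u v.
        h j (transition A i j x) (dir_deriv (transition A i j) x u) (dir_deriv (transition A i j) x v) =
        h i x u v)"

text \<open>Existence of an orthogonal basis without null vectors makes \<open>b\<close> nondegenerate.\<close>

definition has_signature :: "('e::euclidean_space \<Rightarrow> 'e \<Rightarrow> real) \<Rightarrow> nat \<Rightarrow> nat \<Rightarrow> bool" where
  "has_signature b p q \<longleftrightarrow>
     (\<exists>P N. independent (P \<union> N) \<and> span (P \<union> N) = UNIV \<and> card P = p \<and> card N = q \<and>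
        (\<forall>u\<in>P \<union> N. \<forall>v\<in>P \<union> N. u \<noteq> v \<longrightarrow> b u v = 0) \<and>
        (\<forall>u\<in>P. b u u > 0) \<and> (\<forall>u\<in>N. b u u < 0))"

definition pseudo_riemannian_metric ::
  "('a, 'i, 'e::euclidean_space) manifold \<Rightarrow> nat \<Rightarrow> nat \<Rightarrow> ('i, 'e) formfield \<Rightarrow> bool" where
  "pseudo_riemannian_metric A p q h \<longleftrightarrow>
     bilinear_form_field A h \<and>
     (\<forall>i\<in>idx A. \<forall>x\<in>coords A i. (\<forall>u v. h i x u v = h i x v u) \<and> has_signature (h i x) p q)"


section \<open>Affine connections\<close>

text \<open>
  A connection is given by its Christoffel symbols \<open>\<Gamma> i x u v\<close> in each chart, so that
  \<open>(\<nabla>\<^sub>X Y)(x) = DY(x)(X x) + \<Gamma> i x (X x) (Y x)\<close>. The transformation law says exactly that the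
  covariant derivative of a vector field does not depend on the chart.
\<close>

definition affine_connection :: "('a, 'i, 'e::euclidean_space) manifold \<Rightarrow> ('i, 'e) connfield \<Rightarrow> bool" where
  "affine_connection A \<Gamma> \<longleftrightarrow>
     (\<forall>i\<in>idx A. (\<forall>x\<in>coords A i. bilinear (\<Gamma> i x)) \<and>
        (\<forall>u v. smooth_on (coords A i) (\<lambda>x. \<Gamma> i x u v))) \<and>
     (\<forall>i\<in>idx A. \<forall>j\<in>idx A. \<forall>x\<in>overlap A i j. \<forall>u v.
        \<Gamma> j (transition A i j x) (dir_deriv (transition A i j) x u) (dir_deriv (transition A i j) x v) =
        dir_deriv (transition A i j) x (\<Gamma> i x u v)
        - dir_deriv (\<lambda>y. dir_deriv (transition A i j) y v) x u)"

text \<open>Constant coordinate fields commute, so vanishing torsion is symmetry of \<open>\<Gamma> i x\<close>.\<close>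

definition torsion_free :: "('a, 'i, 'e::euclidean_space) manifold \<Rightarrow> ('i, 'e) connfield \<Rightarrow> bool" where
  "torsion_free A \<Gamma> \<longleftrightarrow> (\<forall>i\<in>idx A. \<forall>x\<in>coords A i. \<forall>u v. \<Gamma> i x u v = \<Gamma> i x v u)"

definition metric_connection ::
  "('a, 'i, 'e::euclidean_space) manifold \<Rightarrow> ('i, 'e) formfield \<Rightarrow> ('i, 'e) connfield \<Rightarrow> bool" where
  "metric_connection A h \<Gamma> \<longleftrightarrow>
     (\<forall>i\<in>idx A. \<forall>x\<in>coords A i. \<forall>u v w.
        dir_deriv (\<lambda>y. h i y v w) x u = h i x (\<Gamma> i x u v) w + h i x v (\<Gamma> i x u w))"

text \<open>
  For a pseudo-Riemannian metric \<open>h\<close> such a connection exists and its values on \<open>coords A i\<close> are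
  uniquely determined; hence asserting a property of some such \<open>\<Gamma>\<close> is the same as asserting it of
  the Levi-Civita connection of \<open>h\<close>.
\<close>

definition levi_civita ::
  "('a, 'i, 'e::euclidean_space) manifold \<Rightarrow> ('i, 'e) formfield \<Rightarrow> ('i, 'e) connfield \<Rightarrow> bool" where
  "levi_civita A h \<Gamma> \<longleftrightarrow> affine_connection A \<Gamma> \<and> torsion_free A \<Gamma> \<and> metric_connection A h \<Gamma>"

text \<open>\<open>(\<nabla>\<^sub>u J) v = \<nabla>\<^sub>u (J v) - J (\<nabla>\<^sub>u v)\<close> for constant coordinate fields \<open>u\<close> and \<open>v\<close>.\<close>

definition cov_deriv_endo ::
  "('i, 'e::euclidean_space) connfield \<Rightarrow> ('i, 'e) endofield \<Rightarrow> 'i \<Rightarrow> 'e \<Rightarrow> 'e \<Rightarrow> 'e \<Rightarrow> 'e" where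
  "cov_deriv_endo \<Gamma> J i x u v =
     dir_deriv (\<lambda>y. J i y v) x u + \<Gamma> i x u (J i x v) - J i x (\<Gamma> i x u v)"


section \<open>Holomorphic complex Riemannian manifolds\<close>

definition holomorphic_complex_riemannian ::
  "nat \<Rightarrow> ('a, 'i, 'e::euclidean_space) manifold \<Rightarrow>
   ('i, 'e) endofield \<Rightarrow> ('i, 'e) formfield \<Rightarrow> ('i, 'e) formfield \<Rightarrow> bool" where
  "holomorphic_complex_riemannian n A J h h' \<longleftrightarrow>
     smooth_manifold A \<and> DIM('e) = 2 * n \<and>
     endo_field A J \<and>
     (\<forall>i\<in>idx A. \<forall>x\<in>coords A i. \<forall>v. J i x (J i x v) = - v) \<and>
     pseudo_riemannian_metric A n n h \<and>
     (\<forall>i\<in>idx A. \<forall>x\<in>coords A i. \<forall>u v. h i x (J i x u) (J i x v) = - h i x u v) \<and>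
     (\<forall>i\<in>idx A. \<forall>x\<in>coords A i. \<forall>u v. h' i x u v = h i x (J i x u) v) \<and>
     (\<exists>D. levi_civita A h D \<and>
        (\<forall>i\<in>idx A. \<forall>x\<in>coords A i. \<forall>u v. cov_deriv_endo D J i x u v = 0))"


section \<open>Almost contact complex Riemannian manifolds\<close>

definition almost_contact_complex_riemannian ::
  "nat \<Rightarrow> ('a, 'i, 'e::euclidean_space) manifold \<Rightarrow>
   ('i, 'e) endofield \<Rightarrow> ('i, 'e) vfield \<Rightarrow> ('i, 'e) oneform \<Rightarrow> ('i, 'e) formfield \<Rightarrow> bool" where
  "almost_contact_complex_riemannian n A \<phi> \<xi> \<eta> g \<longleftrightarrow>
     smooth_manifold A \<and> DIM('e) = 2 * n + 1 \<and>
     endo_field A \<phi> \<and> vector_field A \<xi> \<and> one_form A \<eta> \<and>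
     pseudo_riemannian_metric A (n + 1) n g \<and>
     (\<forall>i\<in>idx A. \<forall>x\<in>coords A i.
        \<phi> i x (\<xi> i x) = 0 \<and>
        (\<forall>v. \<phi> i x (\<phi> i x v) = - v + \<eta> i x v *\<^sub>R \<xi> i x) \<and>
        (\<forall>v. \<eta> i x (\<phi> i x v) = 0) \<and>
        \<eta> i x (\<xi> i x) = 1 \<and>
        (\<forall>u v. g i x (\<phi> i x u) (\<phi> i x v) = - g i x u v + \<eta> i x u * \<eta> i x v))"

definition fundamental_tensor ::
  "('i, 'e::euclidean_space) connfield \<Rightarrow> ('i, 'e) endofield \<Rightarrow> ('i, 'e) formfield \<Rightarrow>
   'i \<Rightarrow> 'e \<Rightarrow> 'e \<Rightarrow> 'e \<Rightarrow> 'e \<Rightarrow> real" where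
  "fundamental_tensor \<Gamma> \<phi> g i x u v w = g i x (cov_deriv_endo \<Gamma> \<phi> i x u v) w"

definition sasaki_like ::
  "nat \<Rightarrow> ('a, 'i, 'e::euclidean_space) manifold \<Rightarrow>
   ('i, 'e) endofield \<Rightarrow> ('i, 'e) vfield \<Rightarrow> ('i, 'e) oneform \<Rightarrow> ('i, 'e) formfield \<Rightarrow> bool" where
  "sasaki_like n A \<phi> \<xi> \<eta> g \<longleftrightarrow>
     almost_contact_complex_riemannian n A \<phi> \<xi> \<eta> g \<and>
     (\<exists>\<Gamma>. levi_civita A g \<Gamma> \<and>
        (\<forall>i\<in>idx A. \<forall>x\<in>coords A i. \<forall>X Y Z.
           \<eta> i x X = 0 \<and> \<eta> i x Y = 0 \<and> \<eta> i x Z = 0 \<longrightarrow>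
           fundamental_tensor \<Gamma> \<phi> g i x X Y Z = 0 \<and>
           fundamental_tensor \<Gamma> \<phi> g i x (\<xi> i x) Y Z = 0 \<and>
           fundamental_tensor \<Gamma> \<phi> g i x (\<xi> i x) (\<xi> i x) Z = 0 \<and>
           fundamental_tensor \<Gamma> \<phi> g i x X Y (\<xi> i x) = - g i x X Y))"


section \<open>The structure on the product of a line or circle with \<open>M\<close>\<close>

text \<open>
  A product chart is indexed by a pair \<open>(k, i)\<close>; points and tangent vectors of its image are pairs
  whose first component is the coordinate \<open>t\<close> and the \<open>\<partial>/\<partial>t\<close>-component, respectively.
\<close>

definition product_eta :: "('k \<times> 'i, real \<times> 'e::euclidean_space) oneform" where
  "product_eta = (\<lambda>_ _ (s, _). s)"

definition product_xi :: "('k \<times> 'i, real \<times> 'e::euclidean_space) vfield" where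
  "product_xi = (\<lambda>_ _. (1, 0))"

definition product_phi ::
  "('i, 'e::euclidean_space) endofield \<Rightarrow> ('k \<times> 'i, real \<times> 'e) endofield" where
  "product_phi J = (\<lambda>(_, i) (_, x) (_, v). (0, J i x v))"

definition product_metric ::
  "('i, 'e::euclidean_space) formfield \<Rightarrow> ('i, 'e) formfield \<Rightarrow> ('k \<times> 'i, real \<times> 'e) formfield" where
  "product_metric h h' =
     (\<lambda>(_, i) (t, x) (r, u) (s, v). r * s + cos (2 * t) * h i x u v - sin (2 * t) * h' i x u v)"

end

theory Submission
  imports Defs
begin

text \<open>
  Let \<open>g\<^sub>t = cos(2t) h - sin(2t) h'\<close> be the form induced on the slice at height \<open>t\<close>, where
  \<open>h'(u, v) = h(Ju, v)\<close>, and let \<open>R\<^sub>t = cos(t) - sin(t) J\<close>. Because \<open>J\<close> is self-adjoint for \<open>h\<close>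
  and \<open>J\<^sup>2 = -1\<close>, the double angle formulas say \<open>g\<^sub>t(u, v) = h(R\<^sub>t u, R\<^sub>t v)\<close>. Since \<open>R\<^sub>t\<close> is
  invertible with inverse \<open>R\<^sub>-\<^sub>t\<close>, every \<open>g\<^sub>t\<close> has the signature \<open>(n, n)\<close> of \<open>h\<close>, and
  \<open>g = dt\<^sup>2 + g\<^sub>t\<close> has signature \<open>(n + 1, n)\<close> (\<open>has_signature_rotated_form\<close>,
  \<open>has_signature_line_sum\<close>).

  Two facts determine the Levi-Civita connection of \<open>g\<close>. First, \<open>DJ = 0\<close> makes \<open>D\<close> compatible
  with \<open>h'\<close> as well as with \<open>h\<close> (\<open>dir_deriv_twin\<close>), hence with every \<open>g\<^sub>t\<close>. Second, the double
  angle was chosen so that \<open>\<partial>g\<^sub>t/\<partial>t (u, v) = -2 g\<^sub>t(Ju, v)\<close>: up to sign the second fundamental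
  form of the slices is \<open>g\<^sub>t(Ju, v)\<close>. Together they give, for \<open>X\<close> and \<open>Y\<close> tangent to the slices,
    \<open>\<nabla>\<^sub>X Y = D\<^sub>X Y + g(JX, Y) \<xi>\<close>, \<open>\<nabla>\<^sub>X \<xi> = \<nabla>\<^sub>\<xi> X = - JX\<close>, \<open>\<nabla>\<^sub>\<xi> \<xi> = 0\<close>,
  which is the content of \<open>product_connection\<close> and \<open>\<Gamma>_levi_civita\<close>. In \<open>F(X, Y, Z)\<close> the terms
  with \<open>D\<close> cancel by \<open>DJ = 0\<close>, in \<open>F(\<xi>, Y, Z)\<close> the two terms \<open>JJY\<close> cancel, and what is left is
  \<open>F(X, Y, \<xi>) = g(JX, JY) = - g(X, Y)\<close>.

  The half-line and the circle are treated alike. All that matters is that their changes of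
  coordinate have derivative \<open>1\<close> and preserve \<open>cos(2t)\<close> and \<open>sin(2t)\<close>, so that \<open>dt\<close>, \<open>\<partial>/\<partial>t\<close> and
  the coefficients of \<open>g\<close> do not depend on the chart (\<open>double_angle_curve\<close>). On the circle a
  change of coordinate is locally a translation by a multiple of the period \<open>L\<close>.
\<close>

section \<open>Calculus of smooth maps on open sets\<close>

lemma frechet_derivative_eqI:
  "(f has_derivative f') (at x) \<Longrightarrow> frechet_derivative f (at x) v = f' v"
  using frechet_derivative_at by metis

lemma frechet_derivative_cong_open:
  assumes "open S" "x \<in> S" "\<And>y. y \<in> S \<Longrightarrow> f y = g y"
  shows "frechet_derivative f (at x) = frechet_derivative g (at x)"
proof -
  have "(f has_derivative F) (at x) \<longleftrightarrow> (g has_derivative F) (at x)" for F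
    using assms has_derivative_transform_within_open[of f F x UNIV S g]
      has_derivative_transform_within_open[of g F x UNIV S f] by auto
  then show ?thesis unfolding frechet_derivative_def by simp
qed

lemma differentiable_cong_open:
  assumes "open S" "x \<in> S" "\<And>y. y \<in> S \<Longrightarrow> f y = g y"
  shows "f differentiable (at x) \<longleftrightarrow> g differentiable (at x)"
  unfolding differentiable_def
  using assms has_derivative_transform_within_open[of f _ x UNIV S g]
      has_derivative_transform_within_open[of g _ x UNIV S f] by auto

lemma Ck_on_cong:
  assumes "open S" "\<And>x. x \<in> S \<Longrightarrow> f x = g x"
  shows "Ck_on k S f \<longleftrightarrow> Ck_on k S g"
  using assms(2)
proof (induction k arbitrary: f g)
  case 0
  then show ?case by (simp cong: continuous_on_cong)
next
  case (Suc k)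
  have "f differentiable (at x) \<longleftrightarrow> g differentiable (at x)" if "x \<in> S" for x
    using differentiable_cong_open[OF assms(1) that] Suc.prems by blast
  moreover have "Ck_on k S (\<lambda>x. dir_deriv f x v) \<longleftrightarrow> Ck_on k S (\<lambda>x. dir_deriv g x v)" for v
  proof (rule Suc.IH)
    fix x assume "x \<in> S"
    then have "frechet_derivative f (at x) = frechet_derivative g (at x)"
      using Suc.prems by (rule frechet_derivative_cong_open[OF assms(1)])
    then show "dir_deriv f x v = dir_deriv g x v" by simp
  qed
  ultimately show ?case by simp
qed

text \<open>
  The closure properties below follow by induction from this rule: it allows the derivative to
  be exhibited by the usual differentiation rules instead of being computed as a
  \<open>frechet_derivative\<close>.
\<close>

lemma Ck_on_SucI:
  assumes "open S" "\<And>x. x \<in> S \<Longrightarrow> (f has_derivative f' x) (at x)"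
    and "\<And>v. Ck_on k S (\<lambda>x. f' x v)"
  shows "Ck_on (Suc k) S f"
proof -
  have "Ck_on k S (\<lambda>x. dir_deriv f x v)" for v
    using assms(3)[of v] Ck_on_cong[OF assms(1), of "\<lambda>x. dir_deriv f x v" "\<lambda>x. f' x v" k]
      frechet_derivative_eqI[OF assms(2)] by blast
  moreover have "f differentiable (at x)" if "x \<in> S" for x
    using assms(2)[OF that] unfolding differentiable_def by blast
  ultimately show ?thesis by simp
qed

lemma Ck_on_SucD:
  assumes "Ck_on (Suc k) S f"
  shows "x \<in> S \<Longrightarrow> (f has_derivative frechet_derivative f (at x)) (at x)"
    and "Ck_on k S (\<lambda>x. dir_deriv f x v)"
  using assms by (auto simp: frechet_derivative_works)

lemma Ck_on_lower: "Ck_on (Suc k) S f \<Longrightarrow> Ck_on k S f"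
proof (induction k arbitrary: f)
  case 0
  then show ?case
    by (simp add: continuous_at_imp_continuous_on differentiable_imp_continuous_within)
next
  case (Suc k)
  then show ?case by (metis Ck_on.simps(2))
qed

lemma Ck_on_const: "open S \<Longrightarrow> Ck_on k S (\<lambda>_. c)"
proof (induction k arbitrary: c)
  case (Suc k)
  show ?case
    by (rule Ck_on_SucI[where f' = "\<lambda>_ _. 0"])
       (rule Suc.prems has_derivative_const Suc.IH[OF Suc.prems])+
qed simp

lemma Ck_on_bounded_linear:
  assumes "bounded_linear l" "open S" "Ck_on k S f"
  shows "Ck_on k S (\<lambda>x. l (f x))"
  using assms(3)
proof (induction k arbitrary: f)
  case 0
  then show ?case by (simp add: bounded_linear.continuous_on[OF assms(1)])
next
  case (Suc k)
  show ?case
    by (rule Ck_on_SucI[where f' = "\<lambda>x v. l (dir_deriv f x v)", OF assms(2)])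
       (rule bounded_linear.has_derivative[OF assms(1)] Suc.IH Ck_on_SucD[OF Suc.prems]
         | assumption)+
qed

lemma Ck_on_add:
  assumes "open S" "Ck_on k S f" "Ck_on k S g"
  shows "Ck_on k S (\<lambda>x. f x + g x)"
  using assms(2,3)
proof (induction k arbitrary: f g)
  case 0
  then show ?case by (auto intro: continuous_intros)
next
  case (Suc k)
  show ?case
    by (rule Ck_on_SucI[where f' = "\<lambda>x v. dir_deriv f x v + dir_deriv g x v", OF assms(1)])
       (rule has_derivative_add Suc.IH Ck_on_SucD[OF Suc.prems(1)] Ck_on_SucD[OF Suc.prems(2)]
         | assumption)+
qed

lemma Ck_on_bounded_bilinear:
  assumes "bounded_bilinear p" "open S" "Ck_on k S f" "Ck_on k S g"
  shows "Ck_on k S (\<lambda>x. p (f x) (g x))"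
  using assms(3,4)
proof (induction k arbitrary: f g)
  case 0
  then show ?case by (simp add: bounded_bilinear.continuous_on[OF assms(1)])
next
  case (Suc k)
  show ?case
    by (rule Ck_on_SucI
        [where f' = "\<lambda>x v. p (f x) (dir_deriv g x v) + p (dir_deriv f x v) (g x)", OF assms(2)])
       (rule bounded_bilinear.FDERIV[OF assms(1)] Ck_on_add[OF assms(2)] Suc.IH
          Ck_on_lower[OF Suc.prems(1)] Ck_on_lower[OF Suc.prems(2)]
          Ck_on_SucD[OF Suc.prems(1)] Ck_on_SucD[OF Suc.prems(2)]
         | assumption)+
qed

lemma Ck_on_compose_linear:
  assumes "bounded_linear l" "open S" "open T" "l ` T \<subseteq> S" "Ck_on k S f"
  shows "Ck_on k T (\<lambda>x. f (l x))"
  using assms(5)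
proof (induction k arbitrary: f)
  case 0
  then show ?case
    using assms(4) continuous_on_compose2[OF _ linear_continuous_on[OF assms(1)]]
    by (simp add: image_subset_iff)
next
  case (Suc k)
  show ?case
  proof (rule Ck_on_SucI[where f' = "\<lambda>x v. dir_deriv f (l x) (l v)"])
    fix x assume "x \<in> T"
    then have "(f has_derivative frechet_derivative f (at (l x))) (at (l x))"
      using Ck_on_SucD[OF Suc.prems] assms(4) by blast
    then show "((\<lambda>x. f (l x)) has_derivative (\<lambda>v. dir_deriv f (l x) (l v))) (at x)"
      using has_derivative_compose[OF bounded_linear_imp_has_derivative[OF assms(1)]] by blast
  qed (rule assms(3) Suc.IH Ck_on_SucD[OF Suc.prems])+
qed

lemma smooth_on_cong:
  assumes "open S" "\<And>x. x \<in> S \<Longrightarrow> f x = g x"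
  shows "smooth_on S f \<longleftrightarrow> smooth_on S g"
  using Ck_on_cong[OF assms] by (simp add: smooth_on_def)

lemma smooth_on_const: "open S \<Longrightarrow> smooth_on S (\<lambda>_. c)"
  by (simp add: smooth_on_def Ck_on_const)

lemma smooth_on_bounded_linear:
  "bounded_linear l \<Longrightarrow> open S \<Longrightarrow> smooth_on S f \<Longrightarrow> smooth_on S (\<lambda>x. l (f x))"
  by (simp add: smooth_on_def Ck_on_bounded_linear)

lemma smooth_on_add:
  "open S \<Longrightarrow> smooth_on S f \<Longrightarrow> smooth_on S g \<Longrightarrow> smooth_on S (\<lambda>x. f x + g x)"
  by (simp add: smooth_on_def Ck_on_add)

lemma smooth_on_diff:
  assumes "open S" "smooth_on S f" "smooth_on S g"
  shows "smooth_on S (\<lambda>x. f x - g x)"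
  using smooth_on_add[OF assms(1,2)
      smooth_on_bounded_linear[OF bounded_linear_minus[OF bounded_linear_ident] assms(1,3)]]
  by simp

lemma smooth_on_sum:
  "open S \<Longrightarrow> (\<And>i. i \<in> I \<Longrightarrow> smooth_on S (f i)) \<Longrightarrow> smooth_on S (\<lambda>x. \<Sum>i\<in>I. f i x)"
  by (induction I rule: infinite_finite_induct) (auto intro: smooth_on_const smooth_on_add)

lemma smooth_on_mult:
  fixes f g :: "'a::euclidean_space \<Rightarrow> 'b::real_normed_algebra"
  shows "open S \<Longrightarrow> smooth_on S f \<Longrightarrow> smooth_on S g \<Longrightarrow> smooth_on S (\<lambda>x. f x * g x)"
  by (simp add: smooth_on_def Ck_on_bounded_bilinear[OF bounded_bilinear_mult])

lemma smooth_on_Pair: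
  assumes "open S" "smooth_on S f" "smooth_on S g"
  shows "smooth_on S (\<lambda>x. (f x, g x))"
proof -
  have "smooth_on S (\<lambda>x. (f x, 0) + (0, g x))"
    by (intro smooth_on_add assms smooth_on_bounded_linear[of "\<lambda>a. (a, 0)"]
        smooth_on_bounded_linear[of "\<lambda>a. (0, a)"] bounded_linear_intros)
  then show ?thesis by simp
qed

lemma smooth_on_fst:
  assumes "open S" "open T" "smooth_on S f"
  shows "smooth_on (S \<times> T) (\<lambda>p. f (fst p))"
  using assms(3) unfolding smooth_on_def
  by (intro allI Ck_on_compose_linear[OF bounded_linear_fst assms(1) open_Times[OF assms(1,2)]])
     auto

lemma smooth_on_snd:
  assumes "open S" "open T" "smooth_on T f"
  shows "smooth_on (S \<times> T) (\<lambda>p. f (snd p))"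
  using assms(3) unfolding smooth_on_def
  by (intro allI Ck_on_compose_linear[OF bounded_linear_snd assms(2) open_Times[OF assms(1,2)]])
     auto

lemma smooth_on_cos_sin_double:
  assumes "open S"
  shows "smooth_on S (\<lambda>t::real. cos (2 * t))" "smooth_on S (\<lambda>t::real. sin (2 * t))"
proof -
  \<comment> \<open>The span of the two functions is closed under differentiation, so the induction runs over it.\<close>
  have "Ck_on k S (\<lambda>t. a * cos (2 * t) + b * sin (2 * t))" for a b :: real and k
  proof (induction k arbitrary: a b)
    case 0
    show ?case by (auto intro!: continuous_intros)
  next
    case (Suc k)
    show ?case
    proof (rule Ck_on_SucI
        [where f' = "\<lambda>t v. (2 * b * v) * cos (2 * t) + (- 2 * a * v) * sin (2 * t)"])
      show "((\<lambda>t. a * cos (2 * t) + b * sin (2 * t)) has_derivative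
          (\<lambda>v. (2 * b * v) * cos (2 * t) + (- 2 * a * v) * sin (2 * t))) (at t)" for t
        by (auto intro!: derivative_eq_intros simp: algebra_simps)
    qed (rule assms Suc)+
  qed
  from this[of _ 1 0] this[of _ 0 1]
  show "smooth_on S (\<lambda>t::real. cos (2 * t))" "smooth_on S (\<lambda>t::real. sin (2 * t))"
    by (auto simp: smooth_on_def)
qed

lemma smooth_on_has_derivative:
  assumes "smooth_on S f" "x \<in> S"
  shows "(f has_derivative frechet_derivative f (at x)) (at x)"
  using assms Ck_on_SucD(1) unfolding smooth_on_def by blast

lemma smooth_on_dir_deriv:
  assumes "smooth_on S f"
  shows "smooth_on S (\<lambda>x. dir_deriv f x v)"
  using assms Ck_on_SucD(2) unfolding smooth_on_def by blast

text \<open>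
  A map with the derivative of a translation is smooth, as that derivative is constant.
\<close>

lemma has_derivative_imp_smooth_on:
  assumes "open S" "\<And>x. x \<in> S \<Longrightarrow> (f has_derivative (\<lambda>v. v)) (at x)"
  shows "smooth_on S f"
proof -
  have "Ck_on (Suc k) S f" for k
    by (rule Ck_on_SucI[where f' = "\<lambda>_ v. v"]) (use assms in \<open>auto intro: Ck_on_const\<close>)
  then show ?thesis unfolding smooth_on_def by (blast intro: Ck_on_lower)
qed

section \<open>Products of smooth manifolds\<close>

lemma overlap_subset_coords: "overlap A i j \<subseteq> coords A i"
  by (auto simp: overlap_def coords_def)

lemma smooth_manifold_chart:
  assumes "smooth_manifold A" "i \<in> idx A"
  shows "openin (topo A) (cdom A i)" "open (coords A i)" "inj_on (chart A i) (cdom A i)"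
    and "homeomorphic_map (subtopology (topo A) (cdom A i)) (top_of_set (coords A i)) (chart A i)"
proof -
  show o: "openin (topo A) (cdom A i)" and "open (coords A i)"
    and h: "homeomorphic_map (subtopology (topo A) (cdom A i)) (top_of_set (coords A i)) (chart A i)"
    using assms unfolding smooth_manifold_def by auto
  then show "inj_on (chart A i) (cdom A i)"
    using homeomorphic_imp_injective_map[OF h] openin_subset[OF o]
    by (simp add: Int_absorb1)
qed

text \<open>
  Openness is needed because \<open>smooth_on\<close> and \<open>frechet_derivative\<close> depend only on the values of a
  map on an open set; formulas for transitions are available on overlaps alone.
\<close>

lemma open_overlap:
  assumes "smooth_manifold A" "i \<in> idx A" "j \<in> idx A"
  shows "open (overlap A i j)"
proof -
  note i = smooth_manifold_chart[OF assms(1,2)] and j = smooth_manifold_chart[OF assms(1,3)]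
  have "openin (subtopology (topo A) (cdom A i)) (cdom A i \<inter> cdom A j)"
    using j(1) by (metis inf_commute openin_subtopology_Int)
  moreover have "cdom A i \<inter> cdom A j \<subseteq> topspace (subtopology (topo A) (cdom A i))"
    using openin_subset[OF i(1)] by auto
  ultimately have "openin (top_of_set (coords A i)) (overlap A i j)"
    unfolding overlap_def using homeomorphic_map_openness[OF i(4)] by blast
  then show ?thesis using i(2) openin_open_trans by blast
qed

lemma transition_in_coords:
  assumes "smooth_manifold A" "i \<in> idx A" "x \<in> overlap A i j"
  shows "transition A i j x \<in> coords A j"
proof -
  obtain p where "p \<in> cdom A i" "p \<in> cdom A j" "x = chart A i p"
    using assms(3) unfolding overlap_def by blast
  then show ?thesis
    using smooth_manifold_chart(3)[OF assms(1,2)] by (simp add: transition_def coords_def)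
qed

lemma smooth_on_transition:
  "smooth_manifold A \<Longrightarrow> i \<in> idx A \<Longrightarrow> j \<in> idx A \<Longrightarrow> smooth_on (overlap A i j) (transition A i j)"
  unfolding smooth_manifold_def by blast

lemma product_manifold_simps [simp]:
  "topo (product_manifold T A) = prod_topology (topo T) (topo A)"
  "idx (product_manifold T A) = idx T \<times> idx A"
  "cdom (product_manifold T A) (k, i) = cdom T k \<times> cdom A i"
  "chart (product_manifold T A) (k, i) = map_prod (chart T k) (chart A i)"
  by (simp_all add: product_manifold_def)

lemma coords_product [simp]:
  "coords (product_manifold T A) (k, i) = coords T k \<times> coords A i"
  by (simp add: coords_def map_prod_surj_on)

lemma overlap_product [simp]:
  "overlap (product_manifold T A) (k, i) (l, j) = overlap T k l \<times> overlap A i j"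
  by (simp add: overlap_def map_prod_surj_on Times_Int_Times)

text \<open>
  Off the overlap the two sides differ in general, because \<open>inv_into\<close> chooses arbitrary values
  there.
\<close>

lemma transition_product:
  assumes "smooth_manifold T" "smooth_manifold A" "k \<in> idx T" "i \<in> idx A"
    and "t \<in> overlap T k l" "x \<in> overlap A i j"
  shows "transition (product_manifold T A) (k, i) (l, j) (t, x)
    = (transition T k l t, transition A i j x)"
proof -
  from assms(5,6) obtain p q where p: "p \<in> cdom T k" "t = chart T k p"
    and q: "q \<in> cdom A i" "x = chart A i q" unfolding overlap_def by blast
  have inj: "inj_on (chart T k) (cdom T k)" "inj_on (chart A i) (cdom A i)"
    using assms(1-4) by (simp_all add: smooth_manifold_chart)
  have "inv_into (cdom T k \<times> cdom A i) (map_prod (chart T k) (chart A i)) (t, x) = (p, q)"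
    by (rule inv_into_f_eq[OF map_prod_inj_on[OF inj]]) (simp_all add: p q)
  then show ?thesis using p q inj by (simp add: transition_def)
qed

lemma has_derivative_map_prod:
  assumes "(f has_derivative f') (at t)" "(g has_derivative g') (at x)"
  shows "((\<lambda>p. (f (fst p), g (snd p))) has_derivative (\<lambda>v. (f' (fst v), g' (snd v)))) (at (t, x))"
  by (rule has_derivative_Pair has_derivative_compose[of fst fst _ _ f]
      has_derivative_compose[of snd snd _ _ g] bounded_linear_imp_has_derivative
      bounded_linear_fst bounded_linear_snd | simp add: assms)+

lemma dir_deriv_transition_product:
  assumes "smooth_manifold T" "smooth_manifold A" "k \<in> idx T" "i \<in> idx A" "l \<in> idx T" "j \<in> idx A"
    and "t \<in> overlap T k l" "x \<in> overlap A i j"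
  shows "dir_deriv (transition (product_manifold T A) (k, i) (l, j)) (t, x) (r, u)
    = (dir_deriv (transition T k l) t r, dir_deriv (transition A i j) x u)"
proof -
  have "frechet_derivative (transition (product_manifold T A) (k, i) (l, j)) (at (t, x))
     = frechet_derivative (\<lambda>p. (transition T k l (fst p), transition A i j (snd p))) (at (t, x))"
    using assms transition_product[OF assms(1-4)]
    by (intro frechet_derivative_cong_open[of "overlap T k l \<times> overlap A i j"])
       (auto intro: open_Times open_overlap)
  moreover have "dir_deriv (\<lambda>p. (transition T k l (fst p), transition A i j (snd p))) (t, x) (r, u)
      = (dir_deriv (transition T k l) t r, dir_deriv (transition A i j) x u)"
    using frechet_derivative_eqI[OF has_derivative_map_prod, OF
        smooth_on_has_derivative[OF smooth_on_transition[OF assms(1,3,5)] assms(7)]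
        smooth_on_has_derivative[OF smooth_on_transition[OF assms(2,4,6)] assms(8)]]
    by simp
  ultimately show ?thesis by simp
qed

text \<open>
  Boxes over two countable bases form a countable basis.
\<close>

lemma second_countable_prod_topology:
  assumes "second_countable X" "second_countable Y"
  shows "second_countable (prod_topology X Y)"
proof -
  obtain B where B: "countable B" "\<forall>V\<in>B. openin X V"
    "\<forall>U x. openin X U \<and> x \<in> U \<longrightarrow> (\<exists>V\<in>B. x \<in> V \<and> V \<subseteq> U)"
    using assms(1) unfolding second_countable_def by (elim exE conjE)
  obtain C where C: "countable C" "\<forall>V\<in>C. openin Y V"
    "\<forall>U x. openin Y U \<and> x \<in> U \<longrightarrow> (\<exists>V\<in>C. x \<in> V \<and> V \<subseteq> U)"
    using assms(2) unfolding second_countable_def by (elim exE conjE)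
  let ?D = "(\<lambda>(U, V). U \<times> V) ` (B \<times> C)"
  have D: "countable ?D" using B(1) C(1) by simp
  have op: "\<forall>W\<in>?D. openin (prod_topology X Y) W"
    using B(2) C(2) by (auto simp: openin_prod_Times_iff)
  have base: "\<exists>W\<in>?D. z \<in> W \<and> W \<subseteq> O'" if O': "openin (prod_topology X Y) O' \<and> z \<in> O'" for O' z
  proof -
    obtain x y where z: "z = (x, y)" by fastforce
    obtain U V where U: "openin X U \<and> x \<in> U" and V: "openin Y V \<and> y \<in> V" and UV: "U \<times> V \<subseteq> O'"
      using O'[unfolded openin_prod_topology_alt, THEN conjunct1, rule_format, of x y] O' z by auto
    obtain U' where "U' \<in> B" "x \<in> U'" "U' \<subseteq> U" using B(3)[rule_format, OF U] by auto
    moreover obtain V' where "V' \<in> C" "y \<in> V'" "V' \<subseteq> V" using C(3)[rule_format, OF V] by auto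
    ultimately show ?thesis using UV z by (intro bexI[of _ "U' \<times> V'"]) auto
  qed
  show ?thesis unfolding second_countable_def
    by (intro exI[of _ ?D] conjI allI impI D op) (rule base)
qed

lemma homeomorphic_map_map_prod:
  assumes "homeomorphic_map X X' f" "homeomorphic_map Y Y' g"
  shows "homeomorphic_map (prod_topology X Y) (prod_topology X' Y') (map_prod f g)"
proof -
  obtain f' g' where fg: "homeomorphic_maps X X' f f'" "homeomorphic_maps Y Y' g g'"
    using assms homeomorphic_map_maps by metis
  have "map_prod f g = (\<lambda>(x, y). (f x, g y))" by auto
  then show ?thesis
    using fg homeomorphic_maps_prod[of X Y X' Y' f g f' g'] homeomorphic_map_maps by metis
qed

theorem smooth_manifold_product:
  assumes T: "smooth_manifold T" and A: "smooth_manifold A"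
  shows "smooth_manifold (product_manifold T A)"
  unfolding smooth_manifold_def
proof (intro conjI ballI; (clarsimp)?)
  show "Hausdorff_space (prod_topology (topo T) (topo A))"
    using T A by (simp add: smooth_manifold_def Hausdorff_space_prod_topology)
  show "second_countable (prod_topology (topo T) (topo A))"
    using T A by (simp add: smooth_manifold_def second_countable_prod_topology)
  have "(\<Union>k\<in>idx T. cdom T k) = topspace (topo T)" "(\<Union>i\<in>idx A. cdom A i) = topspace (topo A)"
    using T A by (auto simp: smooth_manifold_def)
  then show "(\<Union>p\<in>idx T \<times> idx A. cdom (product_manifold T A) p)
      = topspace (topo T) \<times> topspace (topo A)"
    by fastforce
next
  fix k i assume k: "k \<in> idx T" and i: "i \<in> idx A"
  note ck = smooth_manifold_chart[OF T k] and ci = smooth_manifold_chart[OF A i]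
  show "openin (prod_topology (topo T) (topo A)) (cdom T k \<times> cdom A i)"
    using ck ci by (simp add: openin_prod_Times_iff)
  show "open (coords T k \<times> coords A i)"
    using ck ci by (simp add: open_Times)
  show "homeomorphic_map (subtopology (prod_topology (topo T) (topo A)) (cdom T k \<times> cdom A i))
      (top_of_set (coords T k \<times> coords A i)) (map_prod (chart T k) (chart A i))"
    using homeomorphic_map_map_prod[OF ck(4) ci(4)]
    by (simp add: subtopology_Times)
  fix l j assume l: "l \<in> idx T" and j: "j \<in> idx A"
  have o: "open (overlap T k l)" "open (overlap A i j)"
    using open_overlap[OF T k l] open_overlap[OF A i j] by auto
  have "smooth_on (overlap T k l \<times> overlap A i j)
      (\<lambda>p. (transition T k l (fst p), transition A i j (snd p)))"
    by (rule smooth_on_Pair open_Times o smooth_on_transition T A k l i j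
        smooth_on_fst[OF _ _ smooth_on_transition] smooth_on_snd[OF _ _ smooth_on_transition])+
  then show "smooth_on (overlap T k l \<times> overlap A i j)
      (transition (product_manifold T A) (k, i) (l, j))"
    by (subst smooth_on_cong[OF open_Times[OF o],
          where g = "\<lambda>p. (transition T k l (fst p), transition A i j (snd p))"])
       (auto simp: transition_product[OF T A k i])
qed

section \<open>The half-line and the circle\<close>

text \<open>
  The one-dimensional factors to which the construction applies: with coordinate changes of this
  kind \<open>dt\<close>, \<open>\<partial>/\<partial>t\<close>, \<open>cos(2t)\<close> and \<open>sin(2t)\<close> are globally defined.
\<close>

definition double_angle_curve :: "('b, 'k, real) manifold \<Rightarrow> bool" where
  "double_angle_curve T \<longleftrightarrow> smooth_manifold T \<and>
     (\<forall>k\<in>idx T. \<forall>l\<in>idx T. \<forall>t\<in>overlap T k l.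
        (transition T k l has_derivative (\<lambda>r. r)) (at t) \<and>
        cos (2 * transition T k l t) = cos (2 * t) \<and> sin (2 * transition T k l t) = sin (2 * t))"

lemma second_countable_top_of_set:
  "second_countable (top_of_set (S :: 'a::second_countable_topology set))"
proof -
  obtain B :: "'a set set" where B: "countable B" "topological_basis B"
    using ex_countable_basis by blast
  have "second_countable (euclidean :: 'a topology)"
    unfolding second_countable_def
  proof (intro exI[of _ B] conjI allI impI ballI)
    fix V assume "V \<in> B"
    then show "openin euclidean V" using B(2) topological_basis_open by auto
  next
    fix U and x :: 'a assume "openin euclidean U \<and> x \<in> U"
    then show "\<exists>V\<in>B. x \<in> V \<and> V \<subseteq> U" using topological_basisE[OF B(2)] by (metis open_openin)
  qed (rule B(1))
  then show ?thesis by (rule second_countable_subtopology)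
qed

lemma double_angle_curve_positive_reals: "double_angle_curve positive_reals"
proof -
  have [simp]: "topo positive_reals = top_of_set {0<..}" "idx positive_reals = UNIV"
      "cdom positive_reals k = {0<..}" "chart positive_reals k = (\<lambda>t. t)" for k
    by (simp_all add: positive_reals_def)
  have [simp]: "coords positive_reals k = {0<..}" "overlap positive_reals k l = {0<..}" for k l
    by (auto simp: coords_def overlap_def)
  have tr: "transition positive_reals k l t = t" if "t > 0" for k l t
    using that by (simp add: transition_def positive_reals_def f_inv_into_f[of t "\<lambda>t. t" "{0<..}"])
  have der: "(transition positive_reals k l has_derivative (\<lambda>r. r)) (at t)" if "t > 0" for k l t
    by (rule has_derivative_transform_within_open[of "\<lambda>t. t" _ _ _ "{0<..}"])
       (use that tr in auto)
  have "smooth_on {0<..} (transition positive_reals k l)" for k l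
    by (rule has_derivative_imp_smooth_on) (simp_all add: der)
  moreover have "homeomorphic_map (top_of_set {0<..}) (top_of_set {0<..}) (\<lambda>t::real. t)"
    using homeomorphic_map_id[of "top_of_set {0::real<..}" "top_of_set {0<..}"] unfolding id_def by simp
  ultimately have "smooth_manifold positive_reals"
    unfolding smooth_manifold_def
    by (simp add: Hausdorff_space_subtopology second_countable_top_of_set subtopology_subtopology)
  then show ?thesis unfolding double_angle_curve_def using der tr by auto
qed

context
  fixes L :: real
  assumes L: "L > 0"
begin

lemma cis_period_eq_iff:
  "cis (2 * pi * s / L) = cis (2 * pi * t / L) \<longleftrightarrow> (\<exists>m::int. s = t + of_int m * L)"
proof -
  have "(2 * pi * s / L = 2 * pi * t / L + 2 * pi * m) \<longleftrightarrow> s = t + m * L" for m :: real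
  proof -
    have "2 * pi * t / L + 2 * pi * m = 2 * pi * (t + m * L) / L"
      using L by (simp add: field_simps)
    then show ?thesis using L by simp
  qed
  then show ?thesis
    using sin_cos_eq_iff[of "2 * pi * s / L" "2 * pi * t / L"] by (auto simp: complex_eq_iff)
qed

lemma period_multiple_zero:
  assumes "\<bar>of_int m * L\<bar> < L"
  shows "m = 0"
proof -
  have "\<bar>of_int m :: real\<bar> < 1" using assms L by (simp add: abs_mult)
  then show ?thesis by linarith
qed

lemma circle_cdom: "cdom (circle L) a = sphere 0 1 - {cis (2 * pi * a / L)}"
  by (simp add: circle_def)

lemma circle_cis_in_cdom:
  assumes "t \<in> {a<..<a + L}"
  shows "cis (2 * pi * t / L) \<in> cdom (circle L) a"
proof -
  have "m = 0" if "t = a + of_int m * L" for m :: int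
    using assms that by (intro period_multiple_zero) auto
  then show ?thesis using assms by (auto simp: circle_cdom cis_period_eq_iff)
qed

lemma circle_chart_cis:
  assumes "t \<in> {a<..<a + L}"
  shows "chart (circle L) a (cis (2 * pi * t / L)) = t"
proof -
  have "s = t" if s: "s \<in> {a<..<a + L}" "cis (2 * pi * s / L) = cis (2 * pi * t / L)" for s
  proof -
    obtain m :: int where m: "s = t + of_int m * L" using s(2) unfolding cis_period_eq_iff by blast
    then have "m = 0" using assms s(1) by (intro period_multiple_zero) auto
    then show ?thesis using m by simp
  qed
  then show ?thesis
    unfolding circle_def using assms by (simp only: manifold.simps) (rule the_equality; blast)
qed

text \<open>
  An explicit formula for the chart of the circle off the class of \<open>a\<close>. Rotating that class to
  \<open>1\<close> moves the omitted point onto the branch cut of \<open>Arg2pi\<close>, which gives both continuity and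
  surjectivity of the chart.
\<close>

definition circle_angle :: "real \<Rightarrow> complex \<Rightarrow> real" where
  "circle_angle a z = a + L / (2 * pi) * Arg2pi (z * cis (- (2 * pi * a / L)))"

lemma rotated_not_nonneg:
  assumes "z \<in> cdom (circle L) a"
  shows "z * cis (- (2 * pi * a / L)) \<notin> \<real>\<^sub>\<ge>\<^sub>0"
proof
  let ?w = "z * cis (- (2 * pi * a / L))"
  assume "?w \<in> \<real>\<^sub>\<ge>\<^sub>0"
  moreover have "norm ?w = 1" using assms by (simp add: circle_cdom norm_mult)
  ultimately have "?w = 1" by (metis nonneg_Reals_cases norm_of_real abs_of_nonneg of_real_1)
  then have "z * (cis (- (2 * pi * a / L)) * cis (2 * pi * a / L)) = cis (2 * pi * a / L)"
    by (metis mult.assoc mult_1)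
  then have "z = cis (2 * pi * a / L)" by (simp add: cis_mult)
  then show False using assms by (simp add: circle_cdom)
qed

lemma circle_angle:
  assumes z: "z \<in> cdom (circle L) a"
  shows "circle_angle a z \<in> {a<..<a + L}" "cis (2 * pi * circle_angle a z / L) = z"
    and "chart (circle L) a z = circle_angle a z"
proof -
  let ?w = "z * cis (- (2 * pi * a / L))"
  have w: "norm ?w = 1" using z by (simp add: circle_cdom norm_mult)
  have cis: "cis (Arg2pi ?w) = ?w"
    using w complex_norm_eq_1_exp[of ?w] by (simp add: cis_conv_exp)
  have "Arg2pi ?w \<noteq> 0"
    using rotated_not_nonneg[OF z] by (metis Arg2pi_eq_0 complex_nonneg_Reals_iff complex_is_Real_iff)
  then have *: "0 < Arg2pi ?w" "Arg2pi ?w < 2 * pi" using Arg2pi_ge_0[of ?w] Arg2pi_lt_2pi by auto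
  have "L / (2 * pi) * Arg2pi ?w < L / (2 * pi) * (2 * pi)"
    using * L by (intro mult_strict_left_mono) auto
  then show in_interval: "circle_angle a z \<in> {a<..<a + L}"
    using * L by (simp add: circle_angle_def)
  have "2 * pi * circle_angle a z / L = Arg2pi ?w + 2 * pi * a / L"
    using L by (simp add: circle_angle_def field_simps)
  then have "cis (2 * pi * circle_angle a z / L) = ?w * cis (2 * pi * a / L)"
    by (simp add: cis cis_mult[symmetric])
  then show eq: "cis (2 * pi * circle_angle a z / L) = z"
    by (simp add: mult.assoc cis_mult)
  show "chart (circle L) a z = circle_angle a z"
    using circle_chart_cis[OF in_interval] unfolding eq .
qed

lemma circle_homeomorphic:
  "homeomorphic_maps (subtopology (topo (circle L)) (cdom (circle L) a))
     (top_of_set {a<..<a + L}) (chart (circle L) a) (\<lambda>t. cis (2 * pi * t / L))"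
proof -
  have "continuous_on (cdom (circle L) a) (circle_angle a)"
    unfolding circle_angle_def
  proof (intro continuous_intros)
    have "continuous_on (UNIV - \<real>\<^sub>\<ge>\<^sub>0) Arg2pi"
      using continuous_at_Arg2pi by (auto intro: continuous_at_imp_continuous_on)
    then show "continuous_on (cdom (circle L) a) (\<lambda>z. Arg2pi (z * cis (- (2 * pi * a / L))))"
      by (rule continuous_on_compose2) (auto intro!: continuous_intros simp: rotated_not_nonneg)
  qed
  then have "continuous_on (cdom (circle L) a) (chart (circle L) a)"
    using circle_angle(3) by (simp cong: continuous_on_cong)
  moreover have "continuous_on {a<..<a + L} (\<lambda>t. cis (2 * pi * t / L))"
    by (intro continuous_intros) (use L in auto)
  moreover have "subtopology (topo (circle L)) (cdom (circle L) a) = top_of_set (cdom (circle L) a)"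
    by (simp add: circle_def subtopology_subtopology Int_Diff inf.absorb2)
  ultimately show ?thesis
    unfolding homeomorphic_maps_def
    using circle_angle circle_chart_cis circle_cis_in_cdom
    by (simp add: image_subset_iff Pi_iff)
qed

lemma circle_coords: "coords (circle L) a = {a<..<a + L}"
  unfolding coords_def
  using circle_angle(1,3)[of _ a] circle_chart_cis[of _ a] circle_cis_in_cdom[of _ a]
  by (auto simp: image_iff) metis

lemma circle_overlap:
  "overlap (circle L) a b = {a<..<a + L} \<inter> {t. cis (2 * pi * t / L) \<noteq> cis (2 * pi * b / L)}"
proof (intro equalityI subsetI)
  fix t assume "t \<in> overlap (circle L) a b"
  then obtain z where z: "z \<in> cdom (circle L) a" "z \<in> cdom (circle L) b" "t = chart (circle L) a z"
    unfolding overlap_def by blast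
  then show "t \<in> {a<..<a + L} \<inter> {t. cis (2 * pi * t / L) \<noteq> cis (2 * pi * b / L)}"
    using circle_angle[OF z(1)] by (simp add: circle_cdom)
next
  fix t assume t: "t \<in> {a<..<a + L} \<inter> {t. cis (2 * pi * t / L) \<noteq> cis (2 * pi * b / L)}"
  then have "cis (2 * pi * t / L) \<in> cdom (circle L) a \<inter> cdom (circle L) b"
    using circle_cis_in_cdom by (simp add: circle_cdom[of b])
  moreover have "t = chart (circle L) a (cis (2 * pi * t / L))"
    using t circle_chart_cis by simp
  ultimately show "t \<in> overlap (circle L) a b" unfolding overlap_def by blast
qed

lemma circle_transition:
  assumes "t \<in> {a<..<a + L}"
  shows "transition (circle L) a b t = chart (circle L) b (cis (2 * pi * t / L))"
proof -
  have "inj_on (chart (circle L) a) (cdom (circle L) a)"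
    by (rule inj_on_inverseI[where g = "\<lambda>t. cis (2 * pi * t / L)"]) (simp add: circle_angle)
  then have "inv_into (cdom (circle L) a) (chart (circle L) a) t = cis (2 * pi * t / L)"
    by (rule inv_into_f_eq) (rule circle_cis_in_cdom circle_chart_cis assms)+
  then show ?thesis by (simp add: transition_def)
qed

text \<open>
  The new coordinate of the point differs from \<open>t\<close> by a multiple \<open>mL\<close> of the period. Both charts
  use open intervals of coordinates, so the same \<open>m\<close> serves for all points nearby.
\<close>

lemma circle_transition_locally_translation:
  assumes "t \<in> overlap (circle L) a b"
  obtains m :: int where "transition (circle L) a b t = t + of_int m * L"
    and "(transition (circle L) a b has_derivative (\<lambda>r. r)) (at t)"
proof -
  let ?z = "cis (2 * pi * t / L)" and ?\<tau> = "transition (circle L) a b"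
  have t: "t \<in> {a<..<a + L}" and z: "?z \<in> cdom (circle L) b"
    using assms by (auto simp: circle_overlap circle_cdom)
  have \<tau>: "?\<tau> t = circle_angle b ?z"
    using circle_transition[OF t] circle_angle(3)[OF z] by simp
  obtain m :: int where m: "?\<tau> t = t + of_int m * L"
    using circle_angle(2)[OF z] unfolding \<tau> cis_period_eq_iff by blast
  let ?U = "{a<..<a + L} \<inter> {b - of_int m * L<..<b - of_int m * L + L}"
  have in_U: "t \<in> ?U" using t circle_angle(1)[OF z] m unfolding \<tau> by auto
  have on_U: "s + of_int m * L = ?\<tau> s" if s: "s \<in> ?U" for s
  proof -
    have "cis (2 * pi * s / L) = cis (2 * pi * (s + of_int m * L) / L)"
      using cis_period_eq_iff[of "s + of_int m * L" s] by auto
    then show ?thesis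
      using s circle_transition[of s a b] circle_chart_cis[of "s + of_int m * L" b] by simp
  qed
  have "((\<lambda>s. s + of_int m * L) has_derivative (\<lambda>r. r)) (at t)"
    by (auto intro!: derivative_eq_intros)
  then have "(?\<tau> has_derivative (\<lambda>r. r)) (at t)"
    by (rule has_derivative_transform_within_open[OF _ _ in_U on_U])
       (simp_all add: open_Int)
  with m show ?thesis by (rule that)
qed

end

lemma periodic_int_multiple:
  fixes f :: "real \<Rightarrow> 'c"
  assumes "\<And>t. f (t + L) = f t"
  shows "f (t + of_int m * L) = f t"
proof (induction m rule: int_induct[where k = 0])
  case (step1 i)
  then show ?case using assms[of "t + of_int i * L"] by (simp add: algebra_simps)
next
  case (step2 i)
  then show ?case using assms[of "t + of_int (i - 1) * L"] by (simp add: algebra_simps)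
qed simp

lemma double_angle_curve_circle:
  assumes L: "L > 0"
    and per: "\<And>t. cos (2 * (t + L)) = cos (2 * t)" "\<And>t. sin (2 * (t + L)) = sin (2 * t)"
  shows "double_angle_curve (circle L)"
proof -
  have der: "(transition (circle L) a b has_derivative (\<lambda>r. r)) (at t)"
    and double: "cos (2 * transition (circle L) a b t) = cos (2 * t)"
      "sin (2 * transition (circle L) a b t) = sin (2 * t)"
    if t: "t \<in> overlap (circle L) a b" for a b t
  proof -
    obtain m :: int where m: "transition (circle L) a b t = t + of_int m * L"
      and d: "(transition (circle L) a b has_derivative (\<lambda>r. r)) (at t)"
      using circle_transition_locally_translation[OF L t] by blast
    show "(transition (circle L) a b has_derivative (\<lambda>r. r)) (at t)" by (rule d)
    show "cos (2 * transition (circle L) a b t) = cos (2 * t)"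
      "sin (2 * transition (circle L) a b t) = sin (2 * t)"
      unfolding m using periodic_int_multiple[of "\<lambda>t. cos (2 * t)" L t m]
        periodic_int_multiple[of "\<lambda>t. sin (2 * t)" L t m] per by simp_all
  qed
  have "open (overlap (circle L) a b)" for a b
    unfolding circle_overlap[OF L]
    by (intro open_Int open_Collect_neq continuous_intros) (use L in auto)
  then have "smooth_on (overlap (circle L) a b) (transition (circle L) a b)" for a b
    by (rule has_derivative_imp_smooth_on) (rule der)
  moreover have "homeomorphic_map (subtopology (topo (circle L)) (cdom (circle L) a))
      (top_of_set (coords (circle L) a)) (chart (circle L) a)" for a
    unfolding circle_coords[OF L] by (rule homeomorphic_maps_imp_map[OF circle_homeomorphic[OF L]])
  moreover have "openin (topo (circle L)) (cdom (circle L) a)" for a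
    by (simp add: circle_def openin_delete)
  moreover have "(\<Union>a\<in>idx (circle L). cdom (circle L) a) = topspace (topo (circle L))"
  proof -
    \<comment> \<open>The charts at \<open>0\<close> and \<open>L / 2\<close> omit the points \<open>1\<close> and \<open>- 1\<close>, respectively.\<close>
    have "cis (2 * pi * 0 / L) \<noteq> cis (2 * pi * (L / 2) / L)"
      using L by (simp add: complex_eq_iff)
    then have "sphere 0 1 \<subseteq>
        (sphere 0 1 - {cis (2 * pi * 0 / L)}) \<union> (sphere 0 1 - {cis (2 * pi * (L / 2) / L)})"
      by blast
    then show ?thesis
      unfolding circle_def by (simp only: manifold.simps topspace_euclidean_subtopology) blast
  qed
  ultimately have "smooth_manifold (circle L)"
    unfolding smooth_manifold_def
    by (simp add: circle_coords[OF L])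
       (simp add: circle_def Hausdorff_space_subtopology second_countable_top_of_set)
  then show ?thesis unfolding double_angle_curve_def using der double by blast
qed

lemma compact_circle: "compact_space (topo (circle L))"
  by (simp add: circle_def compact_space_subtopology)

section \<open>Rotating a form by an anti-isometric complex structure\<close>

text \<open>
  Stated with an inverse \<open>S\<close>, since the orthogonal basis for the pullback is the image of the
  given one under \<open>S\<close>.
\<close>

lemma has_signature_pullback:
  assumes sig: "has_signature b p q" and S: "linear S" and RS: "\<And>v. R (S v) = v" "\<And>v. S (R v) = v"
  shows "has_signature (\<lambda>u v. b (R u) (R v)) p q"
proof -
  obtain P N where PN: "independent (P \<union> N)" "span (P \<union> N) = UNIV" "card P = p" "card N = q"
      and orth: "\<forall>u\<in>P \<union> N. \<forall>v\<in>P \<union> N. u \<noteq> v \<longrightarrow> b u v = 0"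
      and pos: "\<forall>u\<in>P. b u u > 0" and neg: "\<forall>u\<in>N. b u u < 0"
    using sig unfolding has_signature_def by (elim exE conjE)
  have inj: "inj_on S B" for B by (rule inj_on_inverseI[where g = R]) (rule RS)
  have "independent (S ` (P \<union> N))"
    by (rule linear_independent_injective_image[OF S PN(1) inj])
  moreover have "span (S ` (P \<union> N)) = UNIV"
    unfolding linear_span_image[OF S] PN(2) by (metis RS(2) surjI)
  moreover have "card (S ` P) = p" "card (S ` N) = q"
    using PN by (simp_all add: card_image[OF inj])
  moreover have "b u v = 0" if "u \<in> P \<union> N" "v \<in> P \<union> N" "S u \<noteq> S v" for u v
    using orth[rule_format, OF that(1,2)] that(3) by auto
  ultimately show ?thesis
    unfolding has_signature_def
    by - (rule exI[of _ "S ` P"], rule exI[of _ "S ` N"],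
        use pos neg in \<open>auto simp: RS image_Un[symmetric]\<close>)
qed

text \<open>
  An orthogonal basis of the second factor is completed by the unit vector of the line.
\<close>

lemma has_signature_line_sum:
  fixes b :: "'e::euclidean_space \<Rightarrow> 'e \<Rightarrow> real"
  assumes sig: "has_signature b p q" and "bilinear b"
  shows "has_signature (\<lambda>x y. fst x * fst y + b (snd x) (snd y)) (p + 1) q"
proof -
  obtain P N where PN: "independent (P \<union> N)" "span (P \<union> N) = UNIV" "card P = p" "card N = q"
      and orth: "\<forall>u\<in>P \<union> N. \<forall>v\<in>P \<union> N. u \<noteq> v \<longrightarrow> b u v = 0"
      and pos: "\<forall>u\<in>P. b u u > 0" and neg: "\<forall>u\<in>N. b u u < 0"
    using sig unfolding has_signature_def by (elim exE conjE)
  let ?j = "\<lambda>u::'e. (0::real, u)"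
  let ?P = "insert (1, 0) (?j ` P)" and ?N = "?j ` N"
  have lin: "linear ?j" by (rule linearI) auto
  have inj: "inj_on ?j B" for B by (simp add: inj_on_def)
  have fin: "finite P" using independent_imp_finite[OF PN(1)] by simp
  have un: "?P \<union> ?N = insert (1, 0) (?j ` (P \<union> N))" by auto
  have sp: "span (?j ` (P \<union> N)) = range ?j"
    unfolding linear_span_image[OF lin] PN(2) ..
  have "independent (?j ` (P \<union> N))"
    by (rule linear_independent_injective_image[OF lin PN(1) inj])
  moreover have "(1, 0) \<notin> span (?j ` (P \<union> N))"
    unfolding sp by auto
  ultimately have "independent (?P \<union> ?N)"
    unfolding un by (rule independent_insertI[rotated])
  moreover have "span (?P \<union> ?N) = UNIV"
  proof -
    have "x \<in> span (?P \<union> ?N)" for x :: "real \<times> 'e"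
    proof -
      have "x - fst x *\<^sub>R (1, 0) \<in> span (?j ` (P \<union> N))"
        unfolding sp by (rule image_eqI[of _ _ "snd x"]) (simp_all add: prod_eq_iff)
      then show ?thesis unfolding un span_insert by blast
    qed
    then show ?thesis by blast
  qed
  moreover have "(1, 0) \<notin> ?j ` P" by auto
  then have "card ?P = p + 1"
    using PN(3) fin by (simp add: card_insert_disjoint[OF finite_imageI] card_image[OF inj])
  moreover have "card ?N = q"
    using PN(4) by (simp add: card_image[OF inj])
  moreover have "u = v" if "u \<in> P \<union> N" "v \<in> P \<union> N" "b u v \<noteq> 0" for u v
    using orth[rule_format, OF that(1,2)] that(3) by auto
  ultimately show ?thesis
    unfolding has_signature_def
    by - (rule exI[of _ ?P], rule exI[of _ ?N],
        use pos neg bilinear_lzero[OF assms(2)] bilinear_rzero[OF assms(2)] in auto)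
qed

text \<open>
  This is \<open>exp(- t J)\<close> when \<open>J\<^sup>2 = -1\<close>.
\<close>

definition rotation :: "('e::real_vector \<Rightarrow> 'e) \<Rightarrow> real \<Rightarrow> 'e \<Rightarrow> 'e" where
  "rotation J t v = cos t *\<^sub>R v - sin t *\<^sub>R J v"

definition rotated_form :: "('e \<Rightarrow> 'e \<Rightarrow> real) \<Rightarrow> ('e \<Rightarrow> 'e) \<Rightarrow> real \<Rightarrow> 'e \<Rightarrow> 'e \<Rightarrow> real" where
  "rotated_form b J t u v = cos (2 * t) * b u v - sin (2 * t) * b (J u) v"

locale anti_isometric_complex_structure =
  fixes b :: "'e::euclidean_space \<Rightarrow> 'e \<Rightarrow> real" and J :: "'e \<Rightarrow> 'e"
  assumes bilinear: "bilinear b" and symmetric: "b u v = b v u"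
    and linear: "linear J" and square: "J (J v) = - v"
    and anti_isometry: "b (J u) (J v) = - b u v"
begin

lemmas b_simps = bilinear_ladd[OF bilinear] bilinear_radd[OF bilinear]
  bilinear_lsub[OF bilinear] bilinear_rsub[OF bilinear]
  bilinear_lmul[OF bilinear] bilinear_rmul[OF bilinear]
  bilinear_lneg[OF bilinear] bilinear_rneg[OF bilinear]
  bilinear_lzero[OF bilinear] bilinear_rzero[OF bilinear]

lemmas J_simps = linear_add[OF linear] linear_diff[OF linear] linear_scale[OF linear]
  linear_neg[OF linear] linear_0[OF linear] square

lemma self_adjoint: "b u (J v) = b (J u) v"
  using anti_isometry[of u "J v"] by (simp add: J_simps b_simps)

lemma twin_symmetric: "b (J u) v = b (J v) u"
  using self_adjoint[of v u] symmetric[of "J u" v] by simp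

text \<open>
  The reason for the double angle in the metric: the slice metric is the original form pulled
  back along a rotation. By self-adjointness the mixed terms of the right-hand side add up to
  \<open>- 2 cos(t) sin(t) b(Ju, v)\<close>, and by anti-isometry the square terms to
  \<open>(cos(t)\<^sup>2 - sin(t)\<^sup>2) b(u, v)\<close>.
\<close>

lemma rotated_form_eq: "rotated_form b J t u v = b (rotation J t u) (rotation J t v)"
  unfolding rotated_form_def rotation_def cos_double sin_double
  by (simp add: J_simps b_simps self_adjoint anti_isometry power2_eq_square algebra_simps)

lemma rotation_inverse: "rotation J t (rotation J (- t) v) = v"
proof -
  have "rotation J t (rotation J (- t) v) = (cos t * cos t) *\<^sub>R v + (sin t * sin t) *\<^sub>R v"
    by (simp add: rotation_def J_simps algebra_simps)
  also have "\<dots> = v" by (simp flip: scaleR_add_left)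
  finally show ?thesis .
qed

lemma linear_rotation: "linear (rotation J t)"
  by (rule linearI) (simp_all add: rotation_def J_simps algebra_simps)

lemma bilinear_rotated_form: "bilinear (rotated_form b J t)"
  unfolding bilinear_def
  by (auto intro!: linearI simp: rotated_form_def J_simps b_simps algebra_simps)

lemma has_signature_rotated_form:
  assumes "has_signature b p q"
  shows "has_signature (rotated_form b J t) p q"
proof -
  have "has_signature (\<lambda>u v. b (rotation J t u) (rotation J t v)) p q"
    using rotation_inverse[of t] rotation_inverse[of "- t"]
    by (intro has_signature_pullback[OF assms linear_rotation[of "- t"]]) simp_all
  then show ?thesis by (simp add: rotated_form_eq[abs_def])
qed

end

section \<open>Manifolds with a parallel complex structure\<close>

lemma product_phi_eq: "product_phi J (k, i) p v = (0, J i (snd p) (snd v))"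
  by (cases p; cases v) (simp add: product_phi_def)

lemma product_metric_eq:
  "product_metric h h' (k, i) p a b = fst a * fst b
     + (cos (2 * fst p) * h i (snd p) (snd a) (snd b) - sin (2 * fst p) * h' i (snd p) (snd a) (snd b))"
  by (cases p; cases a; cases b) (simp add: product_metric_def)

lemma product_eta_eq: "product_eta p x v = fst v"
  by (cases v) (simp add: product_eta_def)

lemma product_xi_eq: "product_xi p x = (1, 0)"
  by (simp add: product_xi_def)

text \<open>
  Reduces forms evaluated at a variable vector such as \<open>J i x v\<close> to finitely many forms
  evaluated at fixed vectors, the only ones whose dependence on the base point is assumed to be
  smooth.
\<close>

lemma linear_basis_expansion:
  fixes f :: "'e::euclidean_space \<Rightarrow> real"
  assumes "linear f"
  shows "f w = (\<Sum>b\<in>Basis. (w \<bullet> b) * f b)"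
proof -
  have "f w = f (\<Sum>b\<in>Basis. (w \<bullet> b) *\<^sub>R b)" by (simp add: euclidean_representation)
  also have "\<dots> = (\<Sum>b\<in>Basis. (w \<bullet> b) * f b)"
    using assms by (simp add: linear_sum linear_scale)
  finally show ?thesis .
qed

text \<open>
  For \<open>a = (r, u)\<close> and \<open>b = (s, v)\<close> this is \<open>(g\<^sub>t(Ju, v), D(u, v) - r Jv - s Ju)\<close>: the first
  component equals \<open>g\<^sub>t(Ju, v)\<close> because \<open>h'(Ju, v) = - h(u, v)\<close>.
\<close>

definition product_connection ::
  "('i, 'e::euclidean_space) endofield \<Rightarrow> ('i, 'e) formfield \<Rightarrow> ('i, 'e) formfield \<Rightarrow>
   ('i, 'e) connfield \<Rightarrow> ('k \<times> 'i, real \<times> 'e) connfield" where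
  "product_connection J h h' D = (\<lambda>(k, i) p a b.
     (cos (2 * fst p) * h' i (snd p) (snd a) (snd b) + sin (2 * fst p) * h i (snd p) (snd a) (snd b),
      D i (snd p) (snd a) (snd b) - fst a *\<^sub>R J i (snd p) (snd b) - fst b *\<^sub>R J i (snd p) (snd a)))"

text \<open>
  The Levi-Civita connection \<open>D\<close> is a parameter, since the connection of the product is written
  in terms of it.
\<close>

locale parallel_complex_structure =
  fixes n :: nat and M :: "('a, 'i, 'e::euclidean_space) manifold"
    and J :: "('i, 'e) endofield" and h h' :: "('i, 'e) formfield" and D :: "('i, 'e) connfield"
  assumes manifold: "smooth_manifold M" and dim: "DIM('e) = 2 * n"
    and J: "endo_field M J"
    and square: "\<And>i x v. i \<in> idx M \<Longrightarrow> x \<in> coords M i \<Longrightarrow> J i x (J i x v) = - v"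
    and metric: "pseudo_riemannian_metric M n n h"
    and anti: "\<And>i x u v. i \<in> idx M \<Longrightarrow> x \<in> coords M i \<Longrightarrow> h i x (J i x u) (J i x v) = - h i x u v"
    and twin: "\<And>i x u v. i \<in> idx M \<Longrightarrow> x \<in> coords M i \<Longrightarrow> h' i x u v = h i x (J i x u) v"
    and connection: "levi_civita M h D"
    and parallel: "\<And>i x u v. i \<in> idx M \<Longrightarrow> x \<in> coords M i \<Longrightarrow> cov_deriv_endo D J i x u v = 0"
begin

context
  fixes i assumes i: "i \<in> idx M"
begin

lemma open_coords: "open (coords M i)"
  using smooth_manifold_chart(2)[OF manifold i] .

lemma smooth_J: "smooth_on (coords M i) (\<lambda>x. J i x v)"
  using J i unfolding endo_field_def by blast

lemma smooth_h: "smooth_on (coords M i) (\<lambda>x. h i x u v)"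
  using metric i unfolding pseudo_riemannian_metric_def bilinear_form_field_def by blast

lemma smooth_D: "smooth_on (coords M i) (\<lambda>x. D i x u v)"
  using connection i unfolding levi_civita_def affine_connection_def by blast

context
  fixes x assumes x: "x \<in> coords M i"
begin

lemma linear_J: "linear (J i x)"
  using J i x unfolding endo_field_def by blast

lemma anti_isometric: "anti_isometric_complex_structure (h i x) (J i x)"
proof (rule anti_isometric_complex_structure.intro)
  show "bilinear (h i x)" "h i x u v = h i x v u" for u v
    using metric i x unfolding pseudo_riemannian_metric_def bilinear_form_field_def by blast+
qed (use square anti linear_J i x in auto)

lemma signature: "has_signature (h i x) n n"
  using metric i x unfolding pseudo_riemannian_metric_def by blast

lemma bilinear_D: "bilinear (D i x)"
  using connection i x unfolding levi_civita_def affine_connection_def by blast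

lemma D_symmetric: "D i x u v = D i x v u"
  using connection i x unfolding levi_civita_def torsion_free_def by blast

lemma dir_deriv_h: "dir_deriv (\<lambda>y. h i y v w) x u = h i x (D i x u v) w + h i x v (D i x u w)"
  using connection i x unfolding levi_civita_def metric_connection_def by blast

lemma dir_deriv_J: "dir_deriv (\<lambda>y. J i y v) x u = J i x (D i x u v) - D i x u (J i x v)"
  using parallel[OF i x] unfolding cov_deriv_endo_def by (simp add: algebra_simps eq_diff_eq)

interpretation anti_isometric_complex_structure "h i x" "J i x"
  by (rule anti_isometric)

lemma twin_basis_expansion: "h' i x v w = (\<Sum>b\<in>Basis. (J i x v \<bullet> b) * h i x b w)"
  using linear_basis_expansion[of "\<lambda>b. h i x b w" "J i x v"] bilinear
  unfolding twin[OF i x] bilinear_def by simp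

end

lemma smooth_twin: "smooth_on (coords M i) (\<lambda>x. h' i x u v)"
proof -
  have "smooth_on (coords M i) (\<lambda>x. J i x u \<bullet> b)" for b
    by (rule smooth_on_bounded_linear[OF bounded_linear_inner_left open_coords smooth_J])
  then have "smooth_on (coords M i) (\<lambda>x. \<Sum>b\<in>Basis. (J i x u \<bullet> b) * h i x b v)"
    by (intro smooth_on_sum smooth_on_mult open_coords smooth_h)
  then show ?thesis
    by (subst smooth_on_cong[OF open_coords twin_basis_expansion])
qed

text \<open>
  The twin form \<open>h'\<close> is parallel too: differentiating \<open>h(Jv, w)\<close> produces
  \<open>h((\<partial>\<^sub>u J)v + D\<^sub>u(Jv), w) + h(Jv, D\<^sub>u w)\<close>, and the first argument is \<open>J(D\<^sub>u v)\<close> by \<open>DJ = 0\<close>.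
\<close>

lemma dir_deriv_twin:
  assumes x: "x \<in> coords M i"
  shows "dir_deriv (\<lambda>y. h' i y v w) x u = h' i x (D i x u v) w + h' i x v (D i x u w)"
proof -
  interpret anti_isometric_complex_structure "h i x" "J i x"
    by (rule anti_isometric[OF x])
  have "dir_deriv (\<lambda>y. h' i y v w) x u = dir_deriv (\<lambda>y. \<Sum>b\<in>Basis. (J i y v \<bullet> b) * h i y b w) x u"
    using frechet_derivative_cong_open[OF open_coords x twin_basis_expansion] by simp
  also have "\<dots> = (\<Sum>b\<in>Basis. (J i x v \<bullet> b) * dir_deriv (\<lambda>y. h i y b w) x u
      + (dir_deriv (\<lambda>y. J i y v) x u \<bullet> b) * h i x b w)"
    by (rule frechet_derivative_eqI)
       (intro has_derivative_sum has_derivative_mult has_derivative_inner_left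
          smooth_on_has_derivative[OF smooth_J x] smooth_on_has_derivative[OF smooth_h x])
  also have "\<dots> = (\<Sum>b\<in>Basis. (J i x v \<bullet> b) * (h i x (D i x u b) w + h i x b (D i x u w)))
      + (\<Sum>b\<in>Basis. (dir_deriv (\<lambda>y. J i y v) x u \<bullet> b) * h i x b w)"
    by (simp add: sum.distrib dir_deriv_h[OF x])
  also have "\<dots> = (h i x (D i x u (J i x v)) w + h i x (J i x v) (D i x u w))
      + h i x (dir_deriv (\<lambda>y. J i y v) x u) w"
  proof -
    have lin: "linear (\<lambda>b. h i x (D i x u b) w + h i x b (D i x u w))"
      by (rule linearI) (simp_all add: b_simps bilinear_radd[OF bilinear_D[OF x]]
          bilinear_rmul[OF bilinear_D[OF x]] algebra_simps)
    have "linear (\<lambda>b. h i x b w)" using bilinear unfolding bilinear_def by blast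
    from lin this show ?thesis
      by (intro arg_cong2[where f = "(+)"] linear_basis_expansion[symmetric])
  qed
  also have "\<dots> = h i x (J i x (D i x u v)) w + h i x (J i x v) (D i x u w)"
    by (simp add: dir_deriv_J[OF x] b_simps)
  finally show ?thesis by (simp add: twin[OF i x])
qed

end

lemma overlap_coords:
  assumes "i \<in> idx M" "x \<in> overlap M i j"
  shows "x \<in> coords M i" "transition M i j x \<in> coords M j"
  using assms(2) overlap_subset_coords[of M i j] transition_in_coords[OF manifold assms] by auto

context
  fixes i j x assumes ij: "i \<in> idx M" "j \<in> idx M" and x: "x \<in> overlap M i j"
begin

lemma J_transition:
  "J j (transition M i j x) (dir_deriv (transition M i j) x v)
    = dir_deriv (transition M i j) x (J i x v)"
  using J ij x unfolding endo_field_def by blast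

lemma h_transition:
  "h j (transition M i j x) (dir_deriv (transition M i j) x u) (dir_deriv (transition M i j) x v)
    = h i x u v"
  using metric ij x unfolding pseudo_riemannian_metric_def bilinear_form_field_def by blast

lemma twin_transition:
  "h' j (transition M i j x) (dir_deriv (transition M i j) x u) (dir_deriv (transition M i j) x v)
    = h' i x u v"
  using h_transition[of "J i x u" v]
  by (simp add: twin[OF ij(2) overlap_coords(2)[OF ij(1) x]] J_transition
      twin[OF ij(1) overlap_coords(1)[OF ij(1) x]])

lemma D_transition:
  "D j (transition M i j x) (dir_deriv (transition M i j) x u) (dir_deriv (transition M i j) x v)
    = dir_deriv (transition M i j) x (D i x u v)
      - dir_deriv (\<lambda>y. dir_deriv (transition M i j) y v) x u"
  using connection ij x unfolding levi_civita_def affine_connection_def by blast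

end

end

section \<open>The Levi-Civita connection of the product metric\<close>

locale rotated_product = parallel_complex_structure n M J h h' D
  for n :: nat and M :: "('a, 'i, 'e::euclidean_space) manifold"
    and J :: "('i, 'e) endofield" and h h' :: "('i, 'e) formfield" and D :: "('i, 'e) connfield" +
  fixes T :: "('b, 'k, real) manifold"
  assumes curve: "double_angle_curve T"
begin

abbreviation "P \<equiv> product_manifold T M"
abbreviation "\<phi> \<equiv> product_phi J :: ('k \<times> 'i, real \<times> 'e) endofield"
abbreviation "g \<equiv> product_metric h h' :: ('k \<times> 'i, real \<times> 'e) formfield"
abbreviation "\<Gamma> \<equiv> product_connection J h h' D :: ('k \<times> 'i, real \<times> 'e) connfield"

lemma T_manifold: "smooth_manifold T"
  using curve unfolding double_angle_curve_def by blast

lemma P_manifold: "smooth_manifold P"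
  by (rule smooth_manifold_product[OF T_manifold manifold])

lemma connection_eq:
  "\<Gamma> (k, i) p a b =
     (cos (2 * fst p) * h' i (snd p) (snd a) (snd b) + sin (2 * fst p) * h i (snd p) (snd a) (snd b),
      D i (snd p) (snd a) (snd b) - fst a *\<^sub>R J i (snd p) (snd b) - fst b *\<^sub>R J i (snd p) (snd a))"
  by (simp add: product_connection_def)

lemma metric_eq:
  assumes "i \<in> idx M" "snd p \<in> coords M i"
  shows "g (k, i) p a b
    = fst a * fst b + rotated_form (h i (snd p)) (J i (snd p)) (fst p) (snd a) (snd b)"
  by (simp add: product_metric_eq rotated_form_def twin[OF assms])

context
  fixes k i assumes k: "k \<in> idx T" and i: "i \<in> idx M"
begin

lemma open_P_coords: "open (coords T k)" "open (coords M i)" "open (coords T k \<times> coords M i)"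
  using smooth_manifold_chart(2)[OF T_manifold k] open_coords[OF i] by (auto intro: open_Times)

lemma smooth_cos_sin:
  "smooth_on (coords T k \<times> coords M i) (\<lambda>p. cos (2 * fst p))"
  "smooth_on (coords T k \<times> coords M i) (\<lambda>p. sin (2 * fst p))"
  using smooth_on_fst[OF open_P_coords(1,2)] smooth_on_cos_sin_double[OF open_P_coords(1)] by blast+

lemmas smooth_M = smooth_on_snd[OF open_P_coords(1,2)]

lemma smooth_\<phi>: "smooth_on (coords T k \<times> coords M i) (\<lambda>p. \<phi> (k, i) p v)"
  unfolding product_phi_eq
  by (intro smooth_on_Pair smooth_on_const open_P_coords smooth_M[OF smooth_J[OF i]])

lemma smooth_g: "smooth_on (coords T k \<times> coords M i) (\<lambda>p. g (k, i) p a b)"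
  unfolding product_metric_eq
  by (intro smooth_on_add smooth_on_diff smooth_on_mult smooth_on_const open_P_coords smooth_cos_sin
      smooth_M[OF smooth_h[OF i]] smooth_M[OF smooth_twin[OF i]])

lemma smooth_\<Gamma>: "smooth_on (coords T k \<times> coords M i) (\<lambda>p. \<Gamma> (k, i) p a b)"
  unfolding connection_eq
  by (intro smooth_on_Pair smooth_on_add smooth_on_diff smooth_on_mult open_P_coords smooth_cos_sin
      smooth_on_bounded_linear[OF bounded_linear_scaleR_right]
      smooth_M[OF smooth_h[OF i]] smooth_M[OF smooth_twin[OF i]] smooth_M[OF smooth_J[OF i]]
      smooth_M[OF smooth_D[OF i]])

context
  fixes t x assumes t: "t \<in> coords T k" and x: "x \<in> coords M i"
begin

interpretation anti_isometric_complex_structure "h i x" "J i x"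
  by (rule anti_isometric[OF i x])

lemmas D_simps = bilinear_ladd[OF bilinear_D[OF i x]] bilinear_radd[OF bilinear_D[OF i x]]
  bilinear_lmul[OF bilinear_D[OF i x]] bilinear_rmul[OF bilinear_D[OF i x]]

lemma linear_\<phi>: "linear (\<phi> (k, i) (t, x))"
  by (rule linearI) (simp_all add: product_phi_eq J_simps)

lemma bilinear_g: "bilinear (g (k, i) (t, x))"
  unfolding bilinear_def
  by (auto intro!: linearI simp: product_metric_eq twin[OF i x] J_simps b_simps algebra_simps)

lemma g_symmetric: "g (k, i) (t, x) a b = g (k, i) (t, x) b a"
  using symmetric[of "snd a" "snd b"] twin_symmetric[of "snd a" "snd b"]
  by (simp add: product_metric_eq twin[OF i x])

lemma g_signature: "has_signature (g (k, i) (t, x)) (n + 1) n"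
  using has_signature_line_sum[OF has_signature_rotated_form[OF signature[OF i x], of t]
      bilinear_rotated_form]
  by (simp add: metric_eq[OF i, of "(t, x)", simplified, OF x, abs_def])

lemma g_\<phi>_\<phi>: "g (k, i) (t, x) (\<phi> (k, i) (t, x) a) (\<phi> (k, i) (t, x) b)
    = - g (k, i) (t, x) a b + fst a * fst b"
  by (simp add: product_metric_eq product_phi_eq twin[OF i x] anti_isometry J_simps b_simps
      self_adjoint algebra_simps)

lemma bilinear_\<Gamma>: "bilinear (\<Gamma> (k, i) (t, x))"
  unfolding bilinear_def
  by (auto intro!: linearI simp: connection_eq twin[OF i x] J_simps b_simps D_simps algebra_simps)

lemma \<Gamma>_symmetric: "\<Gamma> (k, i) (t, x) a b = \<Gamma> (k, i) (t, x) b a"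
  using symmetric[of "snd a" "snd b"] twin_symmetric[of "snd a" "snd b"]
    D_symmetric[OF i x, of "snd a" "snd b"]
  by (simp add: connection_eq twin[OF i x])

lemma dir_deriv_\<phi>: "dir_deriv (\<lambda>q. \<phi> (k, i) q v) (t, x) a
    = (0, dir_deriv (\<lambda>y. J i y (snd v)) x (snd a))"
proof (rule frechet_derivative_eqI)
  have "((\<lambda>q. (0, J i (snd q) (snd v))) has_derivative
      (\<lambda>a. (0, dir_deriv (\<lambda>y. J i y (snd v)) x (snd a)))) (at (t, x))"
    by (rule has_derivative_map_prod[where f = "\<lambda>_. 0", OF has_derivative_const
          smooth_on_has_derivative[OF smooth_J[OF i] x]])
  then show "((\<lambda>q. \<phi> (k, i) q v) has_derivative
      (\<lambda>a. (0, dir_deriv (\<lambda>y. J i y (snd v)) x (snd a)))) (at (t, x))"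
    unfolding product_phi_eq .
qed

text \<open>
  The \<open>t\<close>-derivative is \<open>-2 r\<close> times \<open>g\<^sub>t(Ju, v)\<close>, with \<open>r\<close> the \<open>\<partial>/\<partial>t\<close>-component of the direction
  and \<open>u\<close>, \<open>v\<close> the components of the arguments along \<open>M\<close>.
\<close>

lemma dir_deriv_g: "dir_deriv (\<lambda>q. g (k, i) q b c) (t, x) a =
    - 2 * fst a * (sin (2 * t) * h i x (snd b) (snd c) + cos (2 * t) * h' i x (snd b) (snd c))
    + (cos (2 * t) * dir_deriv (\<lambda>y. h i y (snd b) (snd c)) x (snd a)
       - sin (2 * t) * dir_deriv (\<lambda>y. h' i y (snd b) (snd c)) x (snd a))"
proof (rule frechet_derivative_eqI)
  have pull: "((\<lambda>q. f (snd q)) has_derivative (\<lambda>a. dir_deriv f x (snd a))) (at (t, x))"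
    if "smooth_on (coords M i) f" for f :: "'e \<Rightarrow> real"
    by (rule has_derivative_compose[OF bounded_linear_imp_has_derivative[OF bounded_linear_snd]])
       (simp add: smooth_on_has_derivative[OF that x])
  show "((\<lambda>q. g (k, i) q b c) has_derivative (\<lambda>a.
      - 2 * fst a * (sin (2 * t) * h i x (snd b) (snd c) + cos (2 * t) * h' i x (snd b) (snd c))
      + (cos (2 * t) * dir_deriv (\<lambda>y. h i y (snd b) (snd c)) x (snd a)
         - sin (2 * t) * dir_deriv (\<lambda>y. h' i y (snd b) (snd c)) x (snd a)))) (at (t, x))"
    unfolding product_metric_eq
    by (rule derivative_eq_intros pull[OF smooth_h[OF i]] pull[OF smooth_twin[OF i]] refl
       | simp add: algebra_simps)+
qed

text \<open>
  Let \<open>a = (r, w)\<close>, \<open>b = (s, u)\<close>, \<open>c = (s', v)\<close>. On the right the terms with \<open>D\<close> match the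
  derivative along \<open>M\<close>, the terms \<open>- r Ju\<close> and \<open>- r Jv\<close> match the \<open>t\<close>-derivative
  \<open>- 2 r g\<^sub>t(Ju, v)\<close>, and the terms with \<open>s\<close> and with \<open>s'\<close> cancel against the \<open>\<xi>\<close>-components, by
  the symmetry of \<open>g\<^sub>t(J-, -)\<close>.
\<close>

lemma metric_compatible: "dir_deriv (\<lambda>q. g (k, i) q b c) (t, x) a
    = g (k, i) (t, x) (\<Gamma> (k, i) (t, x) a b) c + g (k, i) (t, x) b (\<Gamma> (k, i) (t, x) a c)"
proof -
  have sym: "h i x (snd b) (J i x (snd c)) = h i x (J i x (snd b)) (snd c)"
    "h i x (snd b) (J i x (snd a)) = h i x (J i x (snd a)) (snd b)"
    "h i x (snd b) (snd a) = h i x (snd a) (snd b)"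
    using self_adjoint twin_symmetric symmetric by auto
  show ?thesis
    unfolding dir_deriv_g dir_deriv_h[OF i x] dir_deriv_twin[OF i x]
    by (simp add: product_metric_eq connection_eq twin[OF i x] J_simps b_simps sym
        anti_isometry algebra_simps)
qed

text \<open>
  For \<open>a = (r, u)\<close> and \<open>b = (s, v)\<close>, the terms with \<open>D\<close> vanish by \<open>DJ = 0\<close> and \<open>\<nabla>(\<phi> b)\<close> and
  \<open>\<phi>(\<nabla> b)\<close> share the term \<open>- r JJv\<close>; there remains \<open>(g\<^sub>t(Ju, Jv), s JJu)\<close>.
\<close>

lemma cov_deriv_\<phi>: "cov_deriv_endo \<Gamma> \<phi> (k, i) (t, x) a b =
   (cos (2 * t) * h' i x (snd a) (J i x (snd b)) + sin (2 * t) * h i x (snd a) (J i x (snd b)),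
    fst b *\<^sub>R J i x (J i x (snd a)))"
  using parallel[OF i x, of "snd a" "snd b"]
  unfolding cov_deriv_endo_def dir_deriv_\<phi>
  by (simp add: product_phi_eq connection_eq J_simps cov_deriv_endo_def algebra_simps)

lemma fundamental_tensor_\<phi>:
  shows "fst a = 0 \<Longrightarrow> fst b = 0 \<Longrightarrow> fst c = 0 \<Longrightarrow> fundamental_tensor \<Gamma> \<phi> g (k, i) (t, x) a b c = 0"
    and "fst b = 0 \<Longrightarrow> fst c = 0 \<Longrightarrow> fundamental_tensor \<Gamma> \<phi> g (k, i) (t, x) (1, 0) b c = 0"
    and "fundamental_tensor \<Gamma> \<phi> g (k, i) (t, x) (1, 0) (1, 0) c = 0"
    and "fst a = 0 \<Longrightarrow> fst b = 0 \<Longrightarrow>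
      fundamental_tensor \<Gamma> \<phi> g (k, i) (t, x) a b (1, 0) = - g (k, i) (t, x) a b"
  by (simp_all add: fundamental_tensor_def cov_deriv_\<phi> product_metric_eq twin[OF i x] b_simps J_simps
      anti_isometry self_adjoint algebra_simps)

end
end

context
  fixes k l i j t x
  assumes kl: "k \<in> idx T" "l \<in> idx T" and ij: "i \<in> idx M" "j \<in> idx M"
    and t: "t \<in> overlap T k l" and x: "x \<in> overlap M i j"
begin

lemma cos_sin_transition:
  "cos (2 * transition T k l t) = cos (2 * t)"
  "sin (2 * transition T k l t) = sin (2 * t)"
  using curve kl t unfolding double_angle_curve_def by blast+

lemma P_transition: "transition P (k, i) (l, j) (t, x) = (transition T k l t, transition M i j x)"
  by (rule transition_product[OF T_manifold manifold kl(1) ij(1) t x])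

lemma linear_dir_deriv_transition: "linear (frechet_derivative (transition M i j) (at x))"
  using has_derivative_linear smooth_on_has_derivative[OF smooth_on_transition[OF manifold ij] x] .

text \<open>
  The \<open>\<partial>/\<partial>t\<close>-component is unchanged, which makes \<open>dt\<close> and \<open>\<partial>/\<partial>t\<close> invariant.
\<close>

lemma dir_deriv_P_transition:
  "dir_deriv (transition P (k, i) (l, j)) (t, x) a
    = (fst a, dir_deriv (transition M i j) x (snd a))"
proof -
  have "(transition T k l has_derivative (\<lambda>r. r)) (at t)"
    using curve kl t unfolding double_angle_curve_def by blast
  then have "dir_deriv (transition T k l) t r = r" for r by (rule frechet_derivative_eqI)
  then show ?thesis
    using dir_deriv_transition_product[OF T_manifold manifold kl(1) ij(1) kl(2) ij(2) t x,
        of "fst a" "snd a"]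
    by simp
qed

end

text \<open>
  The inhomogeneous term in the transformation law of Christoffel symbols: only \<open>M\<close> contributes.
\<close>

lemma dir_deriv_dir_deriv_P_transition:
  assumes kl: "k \<in> idx T" "l \<in> idx T" and ij: "i \<in> idx M" "j \<in> idx M"
    and t: "t \<in> overlap T k l" and x: "x \<in> overlap M i j"
  shows "dir_deriv (\<lambda>q. dir_deriv (transition P (k, i) (l, j)) q b) (t, x) a
    = (0, dir_deriv (\<lambda>y. dir_deriv (transition M i j) y (snd b)) x (snd a))"
proof -
  have "frechet_derivative (\<lambda>q. dir_deriv (transition P (k, i) (l, j)) q b) (at (t, x))
      = frechet_derivative (\<lambda>q. (fst b, dir_deriv (transition M i j) (snd q) (snd b))) (at (t, x))"
  proof (rule frechet_derivative_cong_open[of "overlap T k l \<times> overlap M i j"])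
    show "open (overlap T k l \<times> overlap M i j)"
      by (intro open_Times open_overlap T_manifold manifold kl ij)
    show "(t, x) \<in> overlap T k l \<times> overlap M i j" using t x by simp
    show "dir_deriv (transition P (k, i) (l, j)) q b
        = (fst b, dir_deriv (transition M i j) (snd q) (snd b))"
      if "q \<in> overlap T k l \<times> overlap M i j" for q
      using that dir_deriv_P_transition[OF kl ij, of "fst q" "snd q" b] by (simp add: mem_Times_iff)
  qed
  moreover have "((\<lambda>q. (fst b, dir_deriv (transition M i j) (snd q) (snd b))) has_derivative
      (\<lambda>a. (0, dir_deriv (\<lambda>y. dir_deriv (transition M i j) y (snd b)) x (snd a)))) (at (t, x))"
    by (rule has_derivative_map_prod[where f = "\<lambda>_. fst b", OF has_derivative_const
          smooth_on_has_derivative[OF smooth_on_dir_deriv[OF smooth_on_transition[OF manifold ij]] x]])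
  ultimately show ?thesis by (simp add: frechet_derivative_eqI)
qed

section \<open>Global structure on the product\<close>

lemma \<phi>_endo_field: "endo_field P \<phi>"
  unfolding endo_field_def
proof (intro conjI ballI allI; clarsimp)
  fix k i assume k: "k \<in> idx T" and i: "i \<in> idx M"
  show "linear (\<phi> (k, i) (t, x))" if "t \<in> coords T k" "x \<in> coords M i" for t x
    by (rule linear_\<phi>[OF k i that])
  show "smooth_on (coords T k \<times> coords M i) (\<lambda>p. \<phi> (k, i) p (r, v))" for r v
    by (rule smooth_\<phi>[OF k i])
  fix l j t x r v assume l: "l \<in> idx T" and j: "j \<in> idx M"
    and t: "t \<in> overlap T k l" and x: "x \<in> overlap M i j"
  show "\<phi> (l, j) (transition P (k, i) (l, j) (t, x))
        (dir_deriv (transition P (k, i) (l, j)) (t, x) (r, v))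
      = dir_deriv (transition P (k, i) (l, j)) (t, x) (\<phi> (k, i) (t, x) (r, v))"
    by (simp add: P_transition[OF k l i j t x] dir_deriv_P_transition[OF k l i j t x] product_phi_eq
        J_transition[OF i j x])
qed

lemma \<xi>_vector_field: "vector_field P product_xi"
  unfolding vector_field_def
proof (intro conjI ballI; clarsimp)
  fix k i assume k: "k \<in> idx T" and i: "i \<in> idx M"
  show "smooth_on (coords T k \<times> coords M i) (product_xi (k, i))"
    unfolding product_xi_def by (rule smooth_on_const[OF open_P_coords(3)[OF k i]])
  fix l j t x assume l: "l \<in> idx T" and j: "j \<in> idx M"
    and t: "t \<in> overlap T k l" and x: "x \<in> overlap M i j"
  show "product_xi (l, j) (transition P (k, i) (l, j) (t, x))
      = dir_deriv (transition P (k, i) (l, j)) (t, x) (product_xi (k, i) (t, x))"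
    by (simp add: dir_deriv_P_transition[OF k l i j t x] product_xi_eq
        linear_0[OF linear_dir_deriv_transition[OF k l i j t x]])
qed

lemma \<eta>_one_form: "one_form P product_eta"
  unfolding one_form_def
proof (intro conjI ballI allI; clarsimp)
  fix k i assume k: "k \<in> idx T" and i: "i \<in> idx M"
  show "linear (product_eta (k, i) (t, x))" for t and x :: 'e
    by (rule linearI) (simp_all add: product_eta_eq)
  show "smooth_on (coords T k \<times> coords M i) (\<lambda>p. product_eta (k, i) p (r, v))" for r v
    unfolding product_eta_eq by (rule smooth_on_const[OF open_P_coords(3)[OF k i]])
  fix l j t x r v assume l: "l \<in> idx T" and j: "j \<in> idx M"
    and t: "t \<in> overlap T k l" and x: "x \<in> overlap M i j"
  show "product_eta (l, j) (transition P (k, i) (l, j) (t, x))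
      (dir_deriv (transition P (k, i) (l, j)) (t, x) (r, v)) = product_eta (k, i) (t, x) (r, v)"
    by (simp add: dir_deriv_P_transition[OF k l i j t x] product_eta_eq)
qed

lemma g_pseudo_riemannian: "pseudo_riemannian_metric P (n + 1) n g"
  unfolding pseudo_riemannian_metric_def bilinear_form_field_def
proof (intro conjI ballI allI; clarsimp)
  fix k i assume k: "k \<in> idx T" and i: "i \<in> idx M"
  show "bilinear (g (k, i) (t, x))" "has_signature (g (k, i) (t, x)) (Suc n) n"
    "g (k, i) (t, x) (r, u) (s, v) = g (k, i) (t, x) (s, v) (r, u)"
    if "t \<in> coords T k" "x \<in> coords M i" for t x r s u v
    using bilinear_g[OF k i that] g_signature[OF k i that] g_symmetric[OF k i that] by auto
  show "smooth_on (coords T k \<times> coords M i) (\<lambda>p. g (k, i) p (r, u) (s, v))" for r s u v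
    by (rule smooth_g[OF k i])
  fix l j t x r u s v assume l: "l \<in> idx T" and j: "j \<in> idx M"
    and t: "t \<in> overlap T k l" and x: "x \<in> overlap M i j"
  show "g (l, j) (transition P (k, i) (l, j) (t, x))
      (dir_deriv (transition P (k, i) (l, j)) (t, x) (r, u))
      (dir_deriv (transition P (k, i) (l, j)) (t, x) (s, v)) = g (k, i) (t, x) (r, u) (s, v)"
    by (simp add: P_transition[OF k l i j t x] dir_deriv_P_transition[OF k l i j t x] product_metric_eq
        h_transition[OF i j x] twin_transition[OF i j x] cos_sin_transition[OF k l i j t x])
qed

text \<open>
  The change of charts affects only the \<open>D\<close>-part of the Christoffel symbols by an inhomogeneous
  term; the added parts are built from \<open>h\<close>, \<open>h'\<close>, \<open>J\<close>, \<open>dt\<close>, \<open>cos(2t)\<close> and \<open>sin(2t)\<close> and are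
  tensorial.
\<close>

theorem \<Gamma>_levi_civita: "levi_civita P g \<Gamma>"
  unfolding levi_civita_def
proof (intro conjI)
  show "affine_connection P \<Gamma>"
    unfolding affine_connection_def
  proof (intro conjI ballI allI; clarsimp)
    fix k i assume k: "k \<in> idx T" and i: "i \<in> idx M"
    show "bilinear (\<Gamma> (k, i) (t, x))" if "t \<in> coords T k" "x \<in> coords M i" for t x
      by (rule bilinear_\<Gamma>[OF k i that])
    show "smooth_on (coords T k \<times> coords M i) (\<lambda>p. \<Gamma> (k, i) p (r, u) (s, v))" for r s u v
      by (rule smooth_\<Gamma>[OF k i])
    fix l j t x r u s v assume l: "l \<in> idx T" and j: "j \<in> idx M"
      and t: "t \<in> overlap T k l" and x: "x \<in> overlap M i j"
    note lin = linear_dir_deriv_transition[OF k l i j t x]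
    show "\<Gamma> (l, j) (transition P (k, i) (l, j) (t, x))
        (dir_deriv (transition P (k, i) (l, j)) (t, x) (r, u))
        (dir_deriv (transition P (k, i) (l, j)) (t, x) (s, v))
      = dir_deriv (transition P (k, i) (l, j)) (t, x) (\<Gamma> (k, i) (t, x) (r, u) (s, v))
        - dir_deriv (\<lambda>q. dir_deriv (transition P (k, i) (l, j)) q (s, v)) (t, x) (r, u)"
      by (simp add: P_transition[OF k l i j t x] dir_deriv_P_transition[OF k l i j t x]
          dir_deriv_dir_deriv_P_transition[OF k l i j t x] connection_eq
          h_transition[OF i j x] twin_transition[OF i j x] J_transition[OF i j x]
          D_transition[OF i j x] cos_sin_transition[OF k l i j t x]
          linear_diff[OF lin] linear_scale[OF lin])
  qed
  show "torsion_free P \<Gamma>"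
    unfolding torsion_free_def by (auto simp: \<Gamma>_symmetric)
  show "metric_connection P g \<Gamma>"
    unfolding metric_connection_def by (clarsimp simp: metric_compatible)
qed

theorem sasaki_like: "sasaki_like n P \<phi> product_xi product_eta g"
  unfolding sasaki_like_def
proof (intro conjI exI[of _ \<Gamma>])
  have "\<phi> (k, i) (t, x) (\<phi> (k, i) (t, x) v) = - v + product_eta (k, i) (t, x) v *\<^sub>R (1, 0)"
    if "i \<in> idx M" "x \<in> coords M i" for k i t x v
    using that by (simp add: product_phi_eq product_eta_eq square prod_eq_iff)
  moreover have "J i x 0 = 0" if "i \<in> idx M" "x \<in> coords M i" for i x
    by (rule linear_0[OF linear_J[OF that]])
  ultimately show "almost_contact_complex_riemannian n P \<phi> product_xi product_eta g"
    unfolding almost_contact_complex_riemannian_def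
    using P_manifold \<phi>_endo_field \<xi>_vector_field \<eta>_one_form g_pseudo_riemannian dim
    by (auto simp: product_xi_eq product_eta_eq g_\<phi>_\<phi>) (simp add: product_phi_eq zero_prod_def)+
  show "levi_civita P g \<Gamma>" by (rule \<Gamma>_levi_civita)
  show "\<forall>p\<in>idx P. \<forall>x\<in>coords P p. \<forall>X Y Z.
      product_eta p x X = 0 \<and> product_eta p x Y = 0 \<and> product_eta p x Z = 0 \<longrightarrow>
      fundamental_tensor \<Gamma> \<phi> g p x X Y Z = 0 \<and>
      fundamental_tensor \<Gamma> \<phi> g p x (product_xi p x) Y Z = 0 \<and>
      fundamental_tensor \<Gamma> \<phi> g p x (product_xi p x) (product_xi p x) Z = 0 \<and>
      fundamental_tensor \<Gamma> \<phi> g p x X Y (product_xi p x) = - g p x X Y"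
    by (clarsimp simp: product_eta_eq product_xi_eq fundamental_tensor_\<phi>)
qed

end

theorem theorem8p4:
  fixes M :: "('a, 'i, 'e::euclidean_space) manifold"
    and J :: "('i, 'e) endofield"
    and h h' :: "('i, 'e) formfield"
    and n :: nat
  assumes "holomorphic_complex_riemannian n M J h h'"
  shows "sasaki_like n (product_manifold positive_reals M)
           (product_phi J) product_xi product_eta (product_metric h h') \<and>
         (compact_space (topo M) \<longrightarrow>
           (\<forall>L>0. (\<forall>t. cos (2 * (t + L)) = cos (2 * t) \<and> sin (2 * (t + L)) = sin (2 * t)) \<longrightarrow>
              compact_space (topo (product_manifold (circle L) M)) \<and>
              sasaki_like n (product_manifold (circle L) M)
                (product_phi J) product_xi product_eta (product_metric h h')))"
proof -
  note hol = assms[unfolded holomorphic_complex_riemannian_def]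
  obtain D where "levi_civita M h D"
    and "\<forall>i\<in>idx M. \<forall>x\<in>coords M i. \<forall>u v. cov_deriv_endo D J i x u v = 0"
    using hol by (elim conjE exE)
  with hol have D: "parallel_complex_structure n M J h h' D"
    by (intro parallel_complex_structure.intro) simp_all
  have sasaki: "sasaki_like n (product_manifold T M)
      (product_phi J) product_xi product_eta (product_metric h h')"
    if "double_angle_curve T" for T :: "('b, 'k, real) manifold"
    by (rule rotated_product.sasaki_like[OF rotated_product.intro[OF D
            rotated_product_axioms.intro[OF that]]])
  show ?thesis
  proof (intro conjI impI allI)
    show "sasaki_like n (product_manifold positive_reals M)
        (product_phi J) product_xi product_eta (product_metric h h')"
      by (rule sasaki[OF double_angle_curve_positive_reals])
    fix L :: real assume L: "L > 0"
      and per: "\<forall>t. cos (2 * (t + L)) = cos (2 * t) \<and> sin (2 * (t + L)) = sin (2 * t)"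
    then show "sasaki_like n (product_manifold (circle L) M)
        (product_phi J) product_xi product_eta (product_metric h h')"
      by (intro sasaki double_angle_curve_circle) auto
    assume "compact_space (topo M)"
    then show "compact_space (topo (product_manifold (circle L) M))"
      by (simp add: compact_space_prod_topology compact_circle)
  qed
qed

end
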